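(* Let $p$ be a prime, let $G$ be a finite group of parabolic characteristic $p$ with $p$ dividing $|G|$, and let $T$ be a $p$-subgroup of $G$. Put $C = T\cdot C_G(T)$ and $O_C = O_p(C)$. If $O_C$ contains a $p$-central element of $G$, then the fixed point set $\mathcal{D}(G)^T$ is $N_G(T)$-contractible.
   Context: For a finite group $X$, $O_p(X)$ is the largest normal $p$-subgroup of $X$. $X$ has characteristic $p$ if $C_X(O_p(X)) \le O_p(X)$. A $p$-local subgroup of $G$ is the normalizer in $G$ of a nontrivial $p$-subgroup; a parabolic subgroup of $G$ is a subgroup containing a Sylow $p$-subgroup of $G$. $G$ has parabolic characteristic $p$ if every $p$-local subgroup of $G$ that is also parabolic has characteristic $p$. An element $x$ of order $p$ in $G$ is $p$-central (in $G$) if it lies in the center of some Sylow $p$-subgroup of $G$. A $p$-subgroup $R$ of $G$ is $p$-radical if $R = O_p(N_G(R))$, and $p$-centric if $Z(R)$ is a Sylow $p$-subgroup of $C_G(R)$. $\mathcal{D}(G)$ is the poset (under inclusion) of nontrivial $p$-subgroups of $G$ that are both $p$-centric and $p$-radical, with $G$ acting by conjugation; topological statements about a poset refer to (the geometric realization of) its order complex. $\mathcal{D}(G)^T=\{Q\in\mathcal{D}(G) : T\le N_G(Q)\}$. A poset with an action of a group $N$ is $N$-contractible if it is $N$-equivariantly homotopy equivalent to a point. *)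

theory Defs
  imports
    "HOL-Analysis.Analysis"
    "HOL-Algebra.Group_Action"
    "HOL-Algebra.Sylow"
    "HOL-Algebra.Multiplicative_Group"
begin

section \<open>Finite groups\<close>

text \<open>A subgroup \<open>H\<close> of \<open>G\<close>, regarded as a group in its own right, is \<open>G\<lparr>carrier := H\<rparr>\<close>.\<close>

definition centralizer :: "('a, 'b) monoid_scheme \<Rightarrow> 'a set \<Rightarrow> 'a set" where
  "centralizer G S = {g \<in> carrier G. \<forall>s\<in>S. g \<otimes>\<^bsub>G\<^esub> s = s \<otimes>\<^bsub>G\<^esub> g}"

definition center :: "('a, 'b) monoid_scheme \<Rightarrow> 'a set" where
  "center G = centralizer G (carrier G)"

definition p_subgroup :: "('a, 'b) monoid_scheme \<Rightarrow> nat \<Rightarrow> 'a set \<Rightarrow> bool" where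
  "p_subgroup G p P \<longleftrightarrow> subgroup P G \<and> (\<exists>n. card P = p ^ n)"

definition sylow_subgroup :: "('a, 'b) monoid_scheme \<Rightarrow> nat \<Rightarrow> 'a set \<Rightarrow> bool" where
  "sylow_subgroup G p P \<longleftrightarrow> subgroup P G \<and> card P = p ^ multiplicity p (order G)"

text \<open>\<open>O\<^sub>p(G)\<close>, the largest normal \<open>p\<close>-subgroup. It exists and is unique if \<open>G\<close> is finite
  and \<open>p\<close> is prime.\<close>

definition p_core :: "('a, 'b) monoid_scheme \<Rightarrow> nat \<Rightarrow> 'a set" where
  "p_core G p =
     (THE P. P \<lhd> G \<and> p_subgroup G p P \<and> (\<forall>Q. Q \<lhd> G \<and> p_subgroup G p Q \<longrightarrow> Q \<subseteq> P))"

definition characteristic_p :: "('a, 'b) monoid_scheme \<Rightarrow> nat \<Rightarrow> bool" where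
  "characteristic_p G p \<longleftrightarrow> centralizer G (p_core G p) \<subseteq> p_core G p"

definition p_local :: "('a, 'b) monoid_scheme \<Rightarrow> nat \<Rightarrow> 'a set \<Rightarrow> bool" where
  "p_local G p H \<longleftrightarrow> (\<exists>P. p_subgroup G p P \<and> P \<noteq> {\<one>\<^bsub>G\<^esub>} \<and> H = normalizer G P)"

definition parabolic :: "('a, 'b) monoid_scheme \<Rightarrow> nat \<Rightarrow> 'a set \<Rightarrow> bool" where
  "parabolic G p H \<longleftrightarrow> subgroup H G \<and> (\<exists>S. sylow_subgroup G p S \<and> S \<subseteq> H)"

definition parabolic_characteristic_p :: "('a, 'b) monoid_scheme \<Rightarrow> nat \<Rightarrow> bool" where
  "parabolic_characteristic_p G p \<longleftrightarrow>
     (\<forall>H. p_local G p H \<and> parabolic G p H \<longrightarrow> characteristic_p (G\<lparr>carrier := H\<rparr>) p)"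

definition p_central :: "('a, 'b) monoid_scheme \<Rightarrow> nat \<Rightarrow> 'a \<Rightarrow> bool" where
  "p_central G p x \<longleftrightarrow>
     x \<in> carrier G \<and> group.ord G x = p \<and>
     (\<exists>S. sylow_subgroup G p S \<and> x \<in> center (G\<lparr>carrier := S\<rparr>))"

definition p_radical :: "('a, 'b) monoid_scheme \<Rightarrow> nat \<Rightarrow> 'a set \<Rightarrow> bool" where
  "p_radical G p R \<longleftrightarrow> p_subgroup G p R \<and> R = p_core (G\<lparr>carrier := normalizer G R\<rparr>) p"

definition p_centric :: "('a, 'b) monoid_scheme \<Rightarrow> nat \<Rightarrow> 'a set \<Rightarrow> bool" where
  "p_centric G p R \<longleftrightarrow>
     p_subgroup G p R \<and>
     sylow_subgroup (G\<lparr>carrier := centralizer G R\<rparr>) p (center (G\<lparr>carrier := R\<rparr>))"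

definition centric_radicals :: "('a, 'b) monoid_scheme \<Rightarrow> nat \<Rightarrow> 'a set set" where
  "centric_radicals G p =
     {Q. p_subgroup G p Q \<and> Q \<noteq> {\<one>\<^bsub>G\<^esub>} \<and> p_centric G p Q \<and> p_radical G p Q}"

definition centric_radicals_fixed ::
  "('a, 'b) monoid_scheme \<Rightarrow> nat \<Rightarrow> 'a set \<Rightarrow> 'a set set" where
  "centric_radicals_fixed G p T = {Q \<in> centric_radicals G p. T \<subseteq> normalizer G Q}"

definition conjugate :: "('a, 'b) monoid_scheme \<Rightarrow> 'a \<Rightarrow> 'a set \<Rightarrow> 'a set" where
  "conjugate G g Q = g <#\<^bsub>G\<^esub> Q #>\<^bsub>G\<^esub> inv\<^bsub>G\<^esub> g"


section \<open>Order complexes\<close>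

definition order_complex :: "'v::order set \<Rightarrow> 'v set set" where
  "order_complex P =
     {\<sigma>. \<sigma> \<subseteq> P \<and> finite \<sigma> \<and> \<sigma> \<noteq> {} \<and> Complete_Partial_Order.chain (\<le>) \<sigma>}"

text \<open>
  Points of the realization of a simplicial complex (a family of nonempty finite vertex sets
  closed under nonempty subsets) are given by their barycentric coordinates, extended by zero.
  The topology is that of pointwise convergence of the coordinates; for a complex with finitely
  many vertices, the only case used here, it coincides with the weak topology determined by the
  closed simplices.
\<close>

definition realization_points :: "'v set set \<Rightarrow> ('v \<Rightarrow> real) set" where
  "realization_points K =
     {\<alpha>. {v. \<alpha> v \<noteq> 0} \<in> K \<and> (\<forall>v. 0 \<le> \<alpha> v) \<and> (\<Sum>v | \<alpha> v \<noteq> 0. \<alpha> v) = 1}"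

definition realization :: "'v set set \<Rightarrow> ('v \<Rightarrow> real) topology" where
  "realization K = top_of_set (realization_points K)"

text \<open>
  The map of realizations induced by a vertex map \<open>f\<close>, namely its affine extension
  \<open>\<Sum>\<^sub>v \<alpha>\<^sub>v v \<mapsto> \<Sum>\<^sub>v \<alpha>\<^sub>v f(v)\<close>.
\<close>

definition affine_extension :: "('v \<Rightarrow> 'w) \<Rightarrow> ('v \<Rightarrow> real) \<Rightarrow> 'w \<Rightarrow> real" where
  "affine_extension f \<alpha> = (\<lambda>w. \<Sum>v | \<alpha> v \<noteq> 0 \<and> f v = w. \<alpha> v)"


section \<open>Equivariant homotopy\<close>

text \<open>
  Below, \<open>N\<close> is the underlying set of the acting group, and \<open>\<phi>\<close>, \<open>\<psi>\<close> are the
  actions on the spaces \<open>X\<close>, \<open>Y\<close>.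
\<close>

definition equivariant ::
  "'g set \<Rightarrow> 'x topology \<Rightarrow> ('g \<Rightarrow> 'x \<Rightarrow> 'x) \<Rightarrow> ('g \<Rightarrow> 'y \<Rightarrow> 'y) \<Rightarrow> ('x \<Rightarrow> 'y) \<Rightarrow> bool" where
  "equivariant N X \<phi> \<psi> f \<longleftrightarrow> (\<forall>g\<in>N. \<forall>x\<in>topspace X. f (\<phi> g x) = \<psi> g (f x))"

definition equivariantly_homotopy_equivalent ::
  "'g set \<Rightarrow> 'x topology \<Rightarrow> ('g \<Rightarrow> 'x \<Rightarrow> 'x) \<Rightarrow> 'y topology \<Rightarrow> ('g \<Rightarrow> 'y \<Rightarrow> 'y) \<Rightarrow> bool" where
  "equivariantly_homotopy_equivalent N X \<phi> Y \<psi> \<longleftrightarrow>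
     (\<exists>f h. continuous_map X Y f \<and> equivariant N X \<phi> \<psi> f \<and>
            continuous_map Y X h \<and> equivariant N Y \<psi> \<phi> h \<and>
            homotopic_with (equivariant N X \<phi> \<phi>) X X (h \<circ> f) id \<and>
            homotopic_with (equivariant N Y \<psi> \<psi>) Y Y (f \<circ> h) id)"

definition equivariantly_contractible ::
  "'g set \<Rightarrow> 'x topology \<Rightarrow> ('g \<Rightarrow> 'x \<Rightarrow> 'x) \<Rightarrow> bool" where
  "equivariantly_contractible N X \<phi> \<longleftrightarrow>
     equivariantly_homotopy_equivalent N X \<phi> (discrete_topology {()}) (\<lambda>_. id)"

definition poset_equivariantly_contractible ::
  "'g set \<Rightarrow> 'v::order set \<Rightarrow> ('g \<Rightarrow> 'v \<Rightarrow> 'v) \<Rightarrow> bool" where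
  "poset_equivariantly_contractible N P \<phi> \<longleftrightarrow>
     equivariantly_contractible N (realization (order_complex P)) (\<lambda>g. affine_extension (\<phi> g))"

end

(*
Let S be the poset of all T-invariant p-subgroups of G that contain a p-central element.

(1) If X is a p-subgroup containing a p-central element x, then C_G(X) has characteristic p: this
    passes from C_G(<x>) upwards along a subnormal chain from <x> to X by Thompson's A x B lemma.
    Hence the radical members of S are exactly the members of D(G)^T.
(2) For Q in D(G)^T the chain of equivariant poset maps Q >= Q n C <= (Q n C) O_C >= O_C shows that
    the inclusion of D(G)^T into S is equivariantly null-homotopic. Here Q n C lies in S because Q,
    being centric, contains Z(P) for every Sylow subgroup P containing Q T.
(3) If Q in S is not radical and Q' = O_p(N_G(Q)), then R >= N_R(Q) <= N_R(Q) Q' >= Q' contracts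
    the part of S above Q. Removing the minimal non-radical members over and over therefore yields
    an equivariant retraction r of |S| onto |D(G)^T|.

Composing the null-homotopy with r contracts |D(G)^T|.
*)
theory Submission
  imports Defs
begin

section \<open>Moving mass along chains\<close>

text \<open>The subgroups in the chain between \<open>Q\<close> and O_C need be neither centric nor
  radical, which is why the null-homotopy has to run in the larger poset. All homotopies must
  commute with the group at every time, so they are given by explicit formulas in barycentric
  coordinates. The straight line between two comparable poset maps can leave the complex, because
  \<open>f v\<close> and \<open>g w\<close> may be incomparable for \<open>v < w\<close>. The
  formula used instead comes from the prism decomposition of |P| x [0,1]. Removing a point q works
  in the join of the part below q, q itself and the part above q. The part below stays put. The part
  above is contracted for a time proportional to the mass at q: time zero leaves it alone, and by
  the time the mass at q equals the mass above, everything above sits at one vertex, which can then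
  absorb mass from q. Counting time in units of mass avoids dividing by a mass that may vanish. The
  minimal non-radical members form an invariant antichain; they are removed simultaneously, since
  choosing one of them would break equivariance.\<close>

definition push :: "'v set \<Rightarrow> ('v \<Rightarrow> 'w) \<Rightarrow> ('v \<Rightarrow> real) \<Rightarrow> 'w \<Rightarrow> real" where
  "push P f u = (\<lambda>v. \<Sum>w\<in>P. if f w = v then u w else 0)"

text \<open>Of the mass at \<open>w\<close>, the part \<open>moved P t u w\<close> lies among the lowest \<open>t\<close> units of the chain
  supporting \<open>u\<close>. Moving masses from the images under \<open>f\<close> to those under \<open>g \<le> f\<close> in this order
  keeps the support a chain at all times.\<close>

definition moved :: "'v::order set \<Rightarrow> real \<Rightarrow> ('v \<Rightarrow> real) \<Rightarrow> 'v \<Rightarrow> real" where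
  "moved P t u w = max 0 (min (u w) (t - (\<Sum>x\<in>{x\<in>P. x < w}. u x)))"

definition slide ::
  "'v::order set \<Rightarrow> ('v \<Rightarrow> 'w) \<Rightarrow> ('v \<Rightarrow> 'w) \<Rightarrow> real \<Rightarrow> ('v \<Rightarrow> real) \<Rightarrow> 'w \<Rightarrow> real" where
  "slide P f g t u =
     (\<lambda>v. \<Sum>w\<in>P. (if f w = v then u w - moved P t u w else 0) +
                   (if g w = v then moved P t u w else 0))"

text \<open>A point of the realization up to its total mass, which may also be 0. The part of a
  point lying above some vertex has this form and must be moved without rescaling.\<close>

definition mass_on :: "'v::order set \<Rightarrow> ('v \<Rightarrow> real) \<Rightarrow> bool" where
  "mass_on P u \<longleftrightarrow> (\<forall>v. 0 \<le> u v) \<and> (\<forall>v. u v \<noteq> 0 \<longrightarrow> v \<in> P) \<and>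
     (\<forall>v w. u v \<noteq> 0 \<longrightarrow> u w \<noteq> 0 \<longrightarrow> v \<le> w \<or> w \<le> v)"

text \<open>The map is constrained only on the support of \<open>u\<close>, here and below: maps
  such as \<open>f q\<close> in the removal of points are controlled only strictly above
  \<open>q\<close>.\<close>

lemma sum_push:
  assumes "finite P" "finite P'" "\<And>w. w \<in> P \<Longrightarrow> u w \<noteq> 0 \<Longrightarrow> f w \<in> P'"
  shows "sum (push P f u) P' = sum u P"
proof -
  have "sum (push P f u) P' = (\<Sum>w\<in>P. \<Sum>v\<in>P'. if f w = v then u w else 0)"
    unfolding push_def by (rule sum.swap)
  also have "\<dots> = sum u P"
  proof (rule sum.cong)
    fix w assume "w \<in> P"
    then show "(\<Sum>v\<in>P'. if f w = v then u w else 0) = u w"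
      using assms by (cases "u w = 0") (auto simp: sum.delta)
  qed simp
  finally show ?thesis .
qed

lemma push_push:
  assumes "finite P" "finite P'" "\<And>w. w \<in> P \<Longrightarrow> u w \<noteq> 0 \<Longrightarrow> f w \<in> P'"
  shows "push P' h (push P f u) = push P (h \<circ> f) u"
proof
  fix v
  have "push P' h (push P f u) v = (\<Sum>x\<in>P'. \<Sum>w\<in>P. if h x = v then if f w = x then u w else 0 else 0)"
    unfolding push_def by (auto intro!: sum.cong)
  also have "\<dots> = (\<Sum>w\<in>P. \<Sum>x\<in>P'. if h x = v then if f w = x then u w else 0 else 0)"
    by (rule sum.swap)
  also have "\<dots> = push P (h \<circ> f) u v"
    unfolding push_def
  proof (rule sum.cong)
    fix w assume "w \<in> P"
    have "(\<Sum>x\<in>P'. if h x = v then if f w = x then u w else 0 else 0)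
        = (\<Sum>x\<in>P'. if f w = x then (if h (f w) = v then u w else 0) else 0)"
      by (rule sum.cong) auto
    then show "(\<Sum>x\<in>P'. if h x = v then if f w = x then u w else 0 else 0)
        = (if (h \<circ> f) w = v then u w else 0)"
      using assms \<open>w \<in> P\<close> by (cases "u w = 0") (auto simp: sum.delta)
  qed simp
  finally show "push P' h (push P f u) v = push P (h \<circ> f) u v" .
qed

lemma push_cong:
  assumes "\<And>w. w \<in> P \<Longrightarrow> u w \<noteq> 0 \<Longrightarrow> f w = f' w"
  shows "push P f u = push P f' u"
  unfolding push_def by (intro ext sum.cong) (use assms in force)+

lemma push_id:
  assumes "finite P" "\<And>v. u v \<noteq> 0 \<Longrightarrow> v \<in> P"
  shows "push P (\<lambda>v. v) u = u"
  unfolding push_def using assms by (fastforce simp: sum.delta)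

lemma push_at:
  assumes "finite P" "inj_on f P" "w \<in> P"
  shows "push P f u (f w) = u w"
proof -
  have "push P f u (f w) = (\<Sum>x\<in>P. if x = w then u w else 0)"
    unfolding push_def by (rule sum.cong) (use assms in \<open>auto dest: inj_onD\<close>)
  with assms show ?thesis by simp
qed

lemma moved_bounds:
  assumes "0 \<le> u w" shows "0 \<le> moved P t u w" "moved P t u w \<le> u w"
  using assms unfolding moved_def by auto

lemma moved_eq_0: "u w = 0 \<Longrightarrow> moved P t u w = 0"
  unfolding moved_def by auto

lemma slide_cong:
  assumes "\<And>w. w \<in> P \<Longrightarrow> u w \<noteq> 0 \<Longrightarrow> f w = f' w"
    and "\<And>w. w \<in> P \<Longrightarrow> u w \<noteq> 0 \<Longrightarrow> g w = g' w"
  shows "slide P f g t u = slide P f' g' t u"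
  unfolding slide_def
proof (intro ext sum.cong refl)
  fix v w assume "w \<in> P"
  then show "(if f w = v then u w - moved P t u w else 0) + (if g w = v then moved P t u w else 0)
    = (if f' w = v then u w - moved P t u w else 0) + (if g' w = v then moved P t u w else 0)"
    using assms[of w] moved_eq_0[of u w P t] by (cases "u w = 0") auto
qed

lemma slide_push_push:
  "slide P f g t u v = push P f (\<lambda>w. u w - moved P t u w) v + push P g (moved P t u) v"
  unfolding slide_def push_def by (rule sum.distrib)

lemma continuous_moved:
  assumes "continuous_on S t" "\<And>w. continuous_on S (\<lambda>s. u s w)"
  shows "continuous_on S (\<lambda>s. moved P (t s) (u s) w)"
  unfolding moved_def by (intro continuous_intros assms)

lemma continuous_on_const_if:
  fixes h :: "_ \<Rightarrow> real"
  assumes "continuous_on S h"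
  shows "continuous_on S (\<lambda>s. if b then h s else 0)"
  using assms by (cases b) auto

lemma continuous_slide:
  assumes "continuous_on S t" "\<And>w. continuous_on S (\<lambda>s. u s w)"
  shows "continuous_on S (\<lambda>s. slide P f g (t s) (u s) v)"
  unfolding slide_def by (intro continuous_intros continuous_on_const_if continuous_moved assms)

lemma continuous_push:
  assumes "\<And>w. continuous_on S (\<lambda>s. u s w)"
  shows "continuous_on S (\<lambda>s. push P f (u s) v)"
  unfolding push_def by (intro continuous_intros continuous_on_const_if assms)

text \<open>Truncation in \<open>moved\<close> covers negative times as well. This generality, like
  that of \<open>slide_end\<close>, lets several slides be added up with each one frozen outside its
  own time interval.\<close>

lemma slide_start:
  assumes "\<And>w. 0 \<le> u w" "t \<le> 0"
  shows "slide P f g t u = push P f u"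
proof -
  have *: "moved P t u w = 0" for w
  proof -
    have "0 \<le> (\<Sum>x\<in>{x\<in>P. x < w}. u x)" by (intro sum_nonneg assms)
    then show ?thesis using assms(1)[of w] assms(2) unfolding moved_def by linarith
  qed
  show ?thesis unfolding slide_def push_def * by (auto intro!: sum.cong)
qed

lemma slide_end:
  assumes "finite P" "\<And>w. 0 \<le> u w" "sum u P \<le> t"
  shows "slide P f g t u = push P g u"
proof -
  have "moved P t u w = u w" if "w \<in> P" for w
  proof -
    have "(\<Sum>x\<in>{x\<in>P. x < w}. u x) + u w = sum u (insert w {x\<in>P. x < w})"
      using assms(1) by simp
    also have "\<dots> \<le> sum u P"
      using assms that by (intro sum_mono2) auto
    finally show ?thesis using assms(2)[of w] assms(3) unfolding moved_def by simp
  qed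
  then show ?thesis unfolding slide_def push_def by (auto intro!: ext sum.cong)
qed

lemma sum_slide:
  assumes "finite P" "finite P'"
    and "\<And>w. w \<in> P \<Longrightarrow> u w \<noteq> 0 \<Longrightarrow> f w \<in> P'" "\<And>w. w \<in> P \<Longrightarrow> u w \<noteq> 0 \<Longrightarrow> g w \<in> P'"
  shows "sum (slide P f g t u) P' = sum u P"
proof -
  have "sum (slide P f g t u) P' = sum (push P f (\<lambda>w. u w - moved P t u w)) P' + sum (push P g (moved P t u)) P'"
    unfolding slide_push_push by (rule sum.distrib)
  also have "\<dots> = sum (\<lambda>w. u w - moved P t u w) P + sum (moved P t u) P"
    by (intro arg_cong2[of _ _ _ _ "(+)"] sum_push assms) (use moved_eq_0 in fastforce)+
  finally show ?thesis by (simp add: sum_subtractf)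
qed

lemma push_slide:
  assumes "finite P" "finite P'"
    and "\<And>w. w \<in> P \<Longrightarrow> u w \<noteq> 0 \<Longrightarrow> f w \<in> P'" "\<And>w. w \<in> P \<Longrightarrow> u w \<noteq> 0 \<Longrightarrow> g w \<in> P'"
  shows "push P' h (slide P f g t u) = slide P (h \<circ> f) (h \<circ> g) t u"
proof
  fix v
  have "push P' h (slide P f g t u) v =
     push P' h (push P f (\<lambda>w. u w - moved P t u w)) v + push P' h (push P g (moved P t u)) v"
    unfolding push_def[of P' h] slide_push_push by (simp flip: sum.distrib) (auto intro!: sum.cong)
  also have "\<dots> = push P (h \<circ> f) (\<lambda>w. u w - moved P t u w) v + push P (h \<circ> g) (moved P t u) v"
    by (subst (1 2) push_push) (use assms moved_eq_0 in fastforce)+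
  finally show "push P' h (slide P f g t u) v = slide P (h \<circ> f) (h \<circ> g) t u v"
    unfolding slide_push_push .
qed

lemma push_sum_reindex:
  assumes "finite P" "bij_betw \<gamma> P P"
  shows "(\<Sum>w\<in>P. F w (push P \<gamma> u w)) = (\<Sum>w\<in>P. F (\<gamma> w) (u w))"
proof -
  have "(\<Sum>w\<in>P. F w (push P \<gamma> u w)) = (\<Sum>w\<in>P. F (\<gamma> w) (push P \<gamma> u (\<gamma> w)))"
    by (rule sum.reindex_bij_betw[OF assms(2), symmetric])
  also have "\<dots> = (\<Sum>w\<in>P. F (\<gamma> w) (u w))"
    using assms push_at[OF assms(1), of \<gamma> _ u] by (intro sum.cong refl) (simp add: bij_betw_def)
  finally show ?thesis .
qed

text \<open>The amount moved at \<open>w\<close> depends only on the mass at \<open>w\<close> and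
  the mass below \<open>w\<close>, and an order automorphism carries both along.\<close>

lemma moved_push:
  assumes "finite P" "bij_betw \<gamma> P P"
    and ord: "\<And>x y. x \<in> P \<Longrightarrow> y \<in> P \<Longrightarrow> \<gamma> x < \<gamma> y \<longleftrightarrow> x < y" and "w \<in> P"
  shows "moved P t (push P \<gamma> u) (\<gamma> w) = moved P t u w"
proof -
  \<comment> \<open>As a sum over all of \<open>P\<close>, the mass below a point can be reindexed
    along the bijection.\<close>
  have *: "(\<Sum>x\<in>{x\<in>P. x < y}. k x) = (\<Sum>x\<in>P. if x < y then k x else 0)" for y and k :: "_ \<Rightarrow> real"
    using assms(1) by (simp add: sum.inter_filter)
  have "(\<Sum>x\<in>{x\<in>P. x < \<gamma> w}. push P \<gamma> u x) = (\<Sum>x\<in>P. if \<gamma> x < \<gamma> w then u x else 0)"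
    unfolding * by (rule push_sum_reindex[OF assms(1,2)])
  also have "\<dots> = (\<Sum>x\<in>{x\<in>P. x < w}. u x)"
    unfolding * by (intro sum.cong refl) (use ord \<open>w \<in> P\<close> in auto)
  finally show ?thesis
    unfolding moved_def using push_at[OF assms(1) _ \<open>w \<in> P\<close>, of \<gamma> u] assms(2)
    by (simp add: bij_betw_def)
qed

lemma slide_push:
  assumes "finite P" "bij_betw \<gamma> P P"
    and ord: "\<And>x y. x \<in> P \<Longrightarrow> y \<in> P \<Longrightarrow> \<gamma> x < \<gamma> y \<longleftrightarrow> x < y"
  shows "slide P f g t (push P \<gamma> u) = slide P (f \<circ> \<gamma>) (g \<circ> \<gamma>) t u"
proof
  fix v
  have "slide P f g t (push P \<gamma> u) v =
    (\<Sum>w\<in>P. (if f (\<gamma> w) = v then push P \<gamma> u (\<gamma> w) - moved P t (push P \<gamma> u) (\<gamma> w) else 0) +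
                   (if g (\<gamma> w) = v then moved P t (push P \<gamma> u) (\<gamma> w) else 0))"
    unfolding slide_def by (rule sum.reindex_bij_betw[OF assms(2), symmetric])
  also have "\<dots> = slide P (f \<circ> \<gamma>) (g \<circ> \<gamma>) t u v"
    unfolding slide_def
    by (intro sum.cong refl)
       (use push_at[OF assms(1), of \<gamma> _ u] assms(2) moved_push[OF assms] in \<open>simp add: bij_betw_def\<close>)
  finally show "slide P f g t (push P \<gamma> u) v = slide P (f \<circ> \<gamma>) (g \<circ> \<gamma>) t u v" .
qed

lemma slide_mass_on:
  assumes fin: "finite P" and u: "mass_on P u"
    and f: "\<And>w. u w \<noteq> 0 \<Longrightarrow> f w \<in> P'" and g: "\<And>w. u w \<noteq> 0 \<Longrightarrow> g w \<in> P'"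
    and mf: "\<And>v w. u v \<noteq> 0 \<Longrightarrow> u w \<noteq> 0 \<Longrightarrow> v \<le> w \<Longrightarrow> f v \<le> f w"
    and mg: "\<And>v w. u v \<noteq> 0 \<Longrightarrow> u w \<noteq> 0 \<Longrightarrow> v \<le> w \<Longrightarrow> g v \<le> g w"
    and gf: "\<And>w. u w \<noteq> 0 \<Longrightarrow> g w \<le> f w"
  shows "mass_on P' (slide P f g t u)"
proof -
  have u0: "0 \<le> u w" for w using u by (auto simp: mass_on_def)
  have mb: "0 \<le> moved P t u w" "moved P t u w \<le> u w" for w
    using moved_bounds[of u w P t] u0[of w] by auto
  have supp: "\<exists>w. u w \<noteq> 0 \<and> w \<in> P \<and> (v = f w \<and> moved P t u w < u w \<or> v = g w \<and> 0 < moved P t u w)"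
    if nz: "slide P f g t u v \<noteq> 0" for v
  proof -
    obtain w where w: "w \<in> P"
      "(if f w = v then u w - moved P t u w else 0) + (if g w = v then moved P t u w else 0) \<noteq> 0"
      using nz unfolding slide_def by (meson sum.not_neutral_contains_not_neutral)
    then show ?thesis using mb[of w]
      by (intro exI[of _ w]) (auto split: if_splits)
  qed
  \<comment> \<open>If mass is left over at \<open>x\<close>, the threshold \<open>t\<close> falls
    short of the mass up to and including \<open>x\<close>. For \<open>x < w\<close> all of that
    mass lies below \<open>w\<close>, so nothing at \<open>w\<close> can have moved.\<close>
  have thr: "\<not> x < w" if "moved P t u x < u x" "0 < moved P t u w" "x \<in> P" "w \<in> P" for x w
  proof
    assume "x < w"
    have "(\<Sum>y\<in>{y\<in>P. y < x}. u y) + u x = sum u (insert x {y\<in>P. y < x})"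
      using fin by simp
    also have "\<dots> \<le> (\<Sum>y\<in>{y\<in>P. y < w}. u y)"
      using fin \<open>x < w\<close> that u0 by (intro sum_mono2) auto
    finally show False using that unfolding moved_def by (auto split: if_splits simp: max_def min_def)
  qed
  have nn: "0 \<le> slide P f g t u v" for v
    unfolding slide_def using mb by (intro sum_nonneg) auto
  have ch: "w \<le> x \<or> x \<le> w" if "u x \<noteq> 0" "u w \<noteq> 0" for x w
    using u that by (auto simp: mass_on_def)
  \<comment> \<open>The only comparison not given by monotonicity of a single map. Moved mass sits
    at \<open>y \<le> x\<close>, whence \<open>g y \<le> g x \<le> f x\<close>.\<close>
  have mix: "g y \<le> f x" if "moved P t u x < u x" "0 < moved P t u y" "x \<in> P" "y \<in> P" "u x \<noteq> 0" "u y \<noteq> 0" for x y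
  proof -
    have "y \<le> x" using ch[of x y] thr[of x y] that by (auto simp: order.order_iff_strict)
    then show ?thesis using mg[of y x] gf[of x] that by (meson order.trans)
  qed
  have "v \<le> w \<or> w \<le> v" if nz: "slide P f g t u v \<noteq> 0" "slide P f g t u w \<noteq> 0" for v w
  proof -
    obtain x y where x: "u x \<noteq> 0" "x \<in> P" "v = f x \<and> moved P t u x < u x \<or> v = g x \<and> 0 < moved P t u x"
      and y: "u y \<noteq> 0" "y \<in> P" "w = f y \<and> moved P t u y < u y \<or> w = g y \<and> 0 < moved P t u y"
      using supp nz by meson
    show ?thesis
      using x y mix ch[of x y] mf[of x y] mf[of y x] mg[of x y] mg[of y x] by blast
  qed
  moreover have "v \<in> P'" if "slide P f g t u v \<noteq> 0" for v
    using supp[OF that] f g by blast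
  ultimately show ?thesis using nn unfolding mass_on_def by blast
qed

section \<open>Realizations of finite posets and actions on them\<close>

lemma realization_points_iff:
  assumes "finite P"
  shows "\<alpha> \<in> realization_points (order_complex P) \<longleftrightarrow> mass_on P \<alpha> \<and> sum \<alpha> P = 1"
proof -
  have eq: "sum \<alpha> {v. \<alpha> v \<noteq> 0} = sum \<alpha> P" if "{v. \<alpha> v \<noteq> 0} \<subseteq> P"
    using that assms by (intro sum.mono_neutral_left) auto
  show ?thesis
  proof
    assume "\<alpha> \<in> realization_points (order_complex P)"
    then show "mass_on P \<alpha> \<and> sum \<alpha> P = 1"
      using eq unfolding realization_points_def order_complex_def mass_on_def
        Complete_Partial_Order.chain_def by auto
  next
    assume R: "mass_on P \<alpha> \<and> sum \<alpha> P = 1"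
    then have s: "{v. \<alpha> v \<noteq> 0} \<subseteq> P" by (auto simp: mass_on_def)
    moreover have "{v. \<alpha> v \<noteq> 0} \<noteq> {}"
    proof
      assume "{v. \<alpha> v \<noteq> 0} = {}"
      then have "sum \<alpha> P = 0" by (intro sum.neutral) auto
      with R show False by simp
    qed
    moreover have "finite {v. \<alpha> v \<noteq> 0}" using s assms finite_subset by blast
    ultimately show "\<alpha> \<in> realization_points (order_complex P)"
      using eq[OF s] R unfolding realization_points_def order_complex_def mass_on_def
        Complete_Partial_Order.chain_def by auto
  qed
qed

lemma affine_extension_eq_push:
  assumes "finite P" "\<And>v. \<alpha> v \<noteq> 0 \<Longrightarrow> v \<in> P"
  shows "affine_extension f \<alpha> = push P f \<alpha>"
proof
  fix w
  have "affine_extension f \<alpha> w = (\<Sum>v\<in>{v\<in>P. f v = w}. \<alpha> v)"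
    unfolding affine_extension_def using assms by (intro sum.mono_neutral_left) auto
  also have "\<dots> = push P f \<alpha> w"
    unfolding push_def using assms(1) by (simp add: sum.inter_filter)
  finally show "affine_extension f \<alpha> w = push P f \<alpha> w" .
qed

lemma mass_on_push:
  assumes "finite P" "mass_on P u"
    and "\<And>w. u w \<noteq> 0 \<Longrightarrow> f w \<in> P'"
    and "\<And>v w. u v \<noteq> 0 \<Longrightarrow> u w \<noteq> 0 \<Longrightarrow> v \<le> w \<Longrightarrow> f v \<le> f w"
  shows "mass_on P' (push P f u)"
proof -
  \<comment> \<open>Viewing the push as a slide from \<open>f\<close> to itself reuses the chain
    argument.\<close>
  have "slide P f f 0 u = push P f u"
    using assms by (intro slide_start) (auto simp: mass_on_def)
  then show ?thesis
    using slide_mass_on[of P u f P' f 0] assms by simp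
qed

lemma realization_points_push:
  assumes "finite P" "finite P'" "f ` P \<subseteq> P'" "mono_on P f"
    and \<alpha>: "\<alpha> \<in> realization_points (order_complex P)"
  shows "affine_extension f \<alpha> = push P f \<alpha>"
    and "push P f \<alpha> \<in> realization_points (order_complex P')"
proof -
  have m: "mass_on P \<alpha>" "sum \<alpha> P = 1" using \<alpha> assms(1) by (simp_all add: realization_points_iff)
  then have s: "\<alpha> v \<noteq> 0 \<Longrightarrow> v \<in> P" for v by (auto simp: mass_on_def)
  show "affine_extension f \<alpha> = push P f \<alpha>"
    using s assms(1) by (rule affine_extension_eq_push[rotated])
  have "mass_on P' (push P f \<alpha>)"
    using m s assms by (intro mass_on_push) (auto dest: mono_onD)
  moreover have "sum (push P f \<alpha>) P' = 1"
    using m s assms by (subst sum_push) auto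
  ultimately show "push P f \<alpha> \<in> realization_points (order_complex P')"
    using assms(2) by (simp add: realization_points_iff)
qed

locale finite_poset_action =
  fixes N :: "'g set" and P :: "'v::order set" and act :: "'g \<Rightarrow> 'v \<Rightarrow> 'v"
  assumes finite_P: "finite P"
    and act_closed: "n \<in> N \<Longrightarrow> v \<in> P \<Longrightarrow> act n v \<in> P"
    and act_le_iff: "n \<in> N \<Longrightarrow> v \<in> P \<Longrightarrow> w \<in> P \<Longrightarrow> act n v \<le> act n w \<longleftrightarrow> v \<le> w"
begin

lemma act_inj: "n \<in> N \<Longrightarrow> inj_on (act n) P"
  by (rule inj_onI) (metis act_le_iff order.antisym order.refl)

lemma act_bij: "n \<in> N \<Longrightarrow> bij_betw (act n) P P"
  by (metis act_closed act_inj bij_betw_def endo_inj_surj finite_P image_subsetI)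

lemma act_less_iff: "n \<in> N \<Longrightarrow> v \<in> P \<Longrightarrow> w \<in> P \<Longrightarrow> act n v < act n w \<longleftrightarrow> v < w"
  by (simp add: act_le_iff less_le_not_le)

abbreviation points where "points \<equiv> realization_points (order_complex P)"

lemma action_subset:
  assumes "P' \<subseteq> P" "\<And>n v. n \<in> N \<Longrightarrow> v \<in> P' \<Longrightarrow> act n v \<in> P'"
  shows "finite_poset_action N P' act"
  using assms finite_P by unfold_locales (auto intro: finite_subset simp: act_le_iff subset_iff)

lemma act_points:
  assumes "n \<in> N" "\<alpha> \<in> points"
  shows "affine_extension (act n) \<alpha> = push P (act n) \<alpha>" "push P (act n) \<alpha> \<in> points"
  using assms act_closed act_le_iff finite_P realization_points_push[of P P "act n" \<alpha>]
  by (auto simp: mono_on_def image_subset_iff)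

end

lemma topspace_realization [simp]: "topspace (realization K) = realization_points K"
  by (simp add: realization_def)

text \<open>The equivariant form of Quillen's homotopy between comparable poset maps. The slide is
  built from the order and the masses alone, so it commutes with order automorphisms at every
  time.\<close>

lemma homotopic_affine_extensions:
  fixes P P' :: "'v::order set" and act :: "'g \<Rightarrow> 'v \<Rightarrow> 'v"
  assumes "finite_poset_action N P act" "finite_poset_action N P' act"
    and f: "\<And>v. v \<in> P \<Longrightarrow> f v \<in> P'" "mono_on P f"
      "\<And>n v. n \<in> N \<Longrightarrow> v \<in> P \<Longrightarrow> f (act n v) = act n (f v)"
    and g: "\<And>v. v \<in> P \<Longrightarrow> g v \<in> P'" "mono_on P g"
      "\<And>n v. n \<in> N \<Longrightarrow> v \<in> P \<Longrightarrow> g (act n v) = act n (g v)"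
    and le: "\<And>v. v \<in> P \<Longrightarrow> g v \<le> f v"
  shows "homotopic_with (equivariant N (realization (order_complex P))
             (\<lambda>n. affine_extension (act n)) (\<lambda>n. affine_extension (act n)))
           (realization (order_complex P)) (realization (order_complex P'))
           (affine_extension f) (affine_extension g)"
proof -
  interpret P: finite_poset_action N P act by fact
  interpret P': finite_poset_action N P' act by fact
  define H where "H = (\<lambda>(t, \<alpha>). slide P f g t \<alpha>)"
  have m: "mass_on P \<alpha>" "sum \<alpha> P = 1" "\<And>v. \<alpha> v \<noteq> 0 \<Longrightarrow> v \<in> P" if "\<alpha> \<in> P.points" for \<alpha>
    using that P.finite_P by (auto simp: realization_points_iff mass_on_def)
  have H: "H (t, \<alpha>) \<in> P'.points" if "\<alpha> \<in> P.points" for t \<alpha>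
    unfolding H_def using m[OF that] f g le P.finite_P P'.finite_P
    by (auto simp: realization_points_iff sum_slide mono_on_def intro!: slide_mass_on)
  have cont: "continuous_on ({0..1} \<times> P.points) H"
  proof (rule continuous_on_coordinatewise_then_product)
    fix v
    have "continuous_on ({0..1} \<times> P.points) (\<lambda>s. slide P f g (fst s) (snd s) v)"
      by (intro continuous_slide continuous_intros
           continuous_on_compose2[OF continuous_on_product_coordinates]) auto
    then show "continuous_on ({0..1} \<times> P.points) (\<lambda>s. H s v)"
      by (simp add: H_def case_prod_unfold)
  qed
  have eq: "H (t, affine_extension (act n) \<alpha>) = affine_extension (act n) (H (t, \<alpha>))"
    if n: "n \<in> N" and \<alpha>: "\<alpha> \<in> P.points" for n t \<alpha>
  proof -
    have "H (t, affine_extension (act n) \<alpha>) = slide P (f \<circ> act n) (g \<circ> act n) t \<alpha>"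
      using n \<alpha> by (simp add: H_def P.act_points slide_push P.finite_P P.act_bij P.act_less_iff)
    also have "\<dots> = slide P (act n \<circ> f) (act n \<circ> g) t \<alpha>"
      by (rule slide_cong) (use n f g in auto)
    also have "\<dots> = push P' (act n) (H (t, \<alpha>))"
      unfolding H_def using f g by (simp add: push_slide P.finite_P P'.finite_P)
    also have "\<dots> = affine_extension (act n) (H (t, \<alpha>))"
      using P'.act_points(1)[OF n H[OF \<alpha>]] by simp
    finally show ?thesis .
  qed
  show ?thesis
  \<comment> \<open>The first goal is that equivariance depends only on the values on the space;
    this holds because the action preserves the set of points.\<close>
  proof (subst homotopic_with)
    fix h k :: "('v \<Rightarrow> real) \<Rightarrow> 'v \<Rightarrow> real"
    assume "\<And>x. x \<in> topspace (realization (order_complex P)) \<Longrightarrow> h x = k x"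
    then show "equivariant N (realization (order_complex P)) (\<lambda>n. affine_extension (act n)) (\<lambda>n. affine_extension (act n)) h
       = equivariant N (realization (order_complex P)) (\<lambda>n. affine_extension (act n)) (\<lambda>n. affine_extension (act n)) k"
      unfolding equivariant_def using P.act_points by auto
  next
    have "continuous_map (prod_topology (top_of_set {0..1}) (realization (order_complex P)))
       (realization (order_complex P')) H"
      unfolding realization_def using cont H by auto
    moreover have "H (0, \<alpha>) = affine_extension f \<alpha>" "H (1, \<alpha>) = affine_extension g \<alpha>" if "\<alpha> \<in> P.points" for \<alpha>
    proof -
      have "affine_extension f \<alpha> = push P f \<alpha>" "affine_extension g \<alpha> = push P g \<alpha>"
        using that f g P.finite_P P'.finite_P
        by (auto intro!: realization_points_push(1)[where P'=P'])
      then show "H (0, \<alpha>) = affine_extension f \<alpha>" "H (1, \<alpha>) = affine_extension g \<alpha>"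
        unfolding H_def using m[OF that] P.finite_P
        by (simp_all add: slide_start slide_end mass_on_def)
    qed
    moreover have "equivariant N (realization (order_complex P)) (\<lambda>n. affine_extension (act n))
        (\<lambda>n. affine_extension (act n)) (\<lambda>x. H (t, x))" for t
      using eq by (simp add: equivariant_def)
    ultimately show "\<exists>H :: real \<times> ('v \<Rightarrow> real) \<Rightarrow> 'v \<Rightarrow> real. continuous_map (prod_topology (top_of_set {0..1}) (realization (order_complex P)))
          (realization (order_complex P')) H \<and>
         (\<forall>x\<in>topspace (realization (order_complex P)). H (0, x) = affine_extension f x) \<and>
         (\<forall>x\<in>topspace (realization (order_complex P)). H (1, x) = affine_extension g x) \<and>
         (\<forall>t\<in>{0..1}. equivariant N (realization (order_complex P)) (\<lambda>n. affine_extension (act n))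
            (\<lambda>n. affine_extension (act n)) (\<lambda>x. H (t, x)))"
      by (intro exI[of _ H]) auto
  qed
qed

section \<open>Removing points with conically contractible upper links\<close>

text \<open>For \<open>q\<close> outside \<open>D\<close> the zigzag
  \<open>v \<ge> f q v \<le> g q v \<ge> c q\<close> contracts the part of \<open>P\<close> strictly
  above \<open>q\<close>. The strict inequalities \<open>q < f q v\<close> and
  \<open>q < c q\<close> keep the contraction inside that part.\<close>

locale conical_above = finite_poset_action +
  fixes D :: "'b set" and f g :: "'b \<Rightarrow> 'b \<Rightarrow> 'b" and c :: "'b \<Rightarrow> 'b"
  assumes D_subset: "D \<subseteq> P"
    and act_D: "n \<in> N \<Longrightarrow> v \<in> P \<Longrightarrow> act n v \<in> D \<longleftrightarrow> v \<in> D"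
    and f_closed: "q \<in> P - D \<Longrightarrow> v \<in> P \<Longrightarrow> q < v \<Longrightarrow> f q v \<in> P \<and> q < f q v \<and> f q v \<le> v"
    and g_closed: "q \<in> P - D \<Longrightarrow> v \<in> P \<Longrightarrow> q < v \<Longrightarrow> g q v \<in> P \<and> f q v \<le> g q v"
    and c_closed: "q \<in> P - D \<Longrightarrow> c q \<in> P \<and> q < c q"
    and c_le_g: "q \<in> P - D \<Longrightarrow> v \<in> P \<Longrightarrow> q < v \<Longrightarrow> c q \<le> g q v"
    and f_mono: "q \<in> P - D \<Longrightarrow> v \<in> P \<Longrightarrow> w \<in> P \<Longrightarrow> q < v \<Longrightarrow> v \<le> w \<Longrightarrow> f q v \<le> f q w"
    and g_mono: "q \<in> P - D \<Longrightarrow> v \<in> P \<Longrightarrow> w \<in> P \<Longrightarrow> q < v \<Longrightarrow> v \<le> w \<Longrightarrow> g q v \<le> g q w"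
    and f_act: "n \<in> N \<Longrightarrow> q \<in> P - D \<Longrightarrow> v \<in> P \<Longrightarrow> q < v \<Longrightarrow> f (act n q) (act n v) = act n (f q v)"
    and g_act: "n \<in> N \<Longrightarrow> q \<in> P - D \<Longrightarrow> v \<in> P \<Longrightarrow> q < v \<Longrightarrow> g (act n q) (act n v) = act n (g q v)"
    and c_act: "n \<in> N \<Longrightarrow> q \<in> P - D \<Longrightarrow> c (act n q) = act n (c q)"
begin

definition bottom :: "'b set" where
  "bottom = {q \<in> P - D. \<forall>r\<in>P - D. r \<le> q \<longrightarrow> r = q}"

definition upper :: "'b \<Rightarrow> ('b \<Rightarrow> real) \<Rightarrow> 'b \<Rightarrow> real" where
  "upper q \<alpha> = (\<lambda>v. if q < v then \<alpha> v else 0)"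

text \<open>With \<open>b\<close> the mass of \<open>u\<close>, the three stages of the contraction run for \<open>t\<close> in
  \<open>[0, b]\<close>, \<open>[b, 2 b]\<close> and \<open>[2 b, \<infinity>)\<close>. Outside its interval the slide of a stage is constant and
  equals a \<open>push\<close>, so that the sum below telescopes to the active stage.\<close>

definition cone :: "'b \<Rightarrow> ('b \<Rightarrow> real) \<Rightarrow> 'b \<Rightarrow> real" where
  "cone q \<alpha> = (let u = upper q \<alpha>; t = 3 * \<alpha> q; b = sum u P in
     (\<lambda>v. slide P (\<lambda>w. w) (f q) t u v + (slide P (g q) (f q) (2 * b - t) u v - push P (f q) u v)
       + (slide P (g q) (\<lambda>_. c q) (t - 2 * b) u v - push P (g q) u v)))"

text \<open>Written as a correction that vanishes for \<open>\<alpha> q = 0\<close>, so that the sum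
  over all of \<open>bottom\<close> needs no case distinction and is visibly continuous. The excess
  of the mass at \<open>q\<close> over the mass above it goes to \<open>c q\<close>, which prevents
  total loss of mass when nothing lies above \<open>q\<close>.\<close>

definition shift :: "'b \<Rightarrow> ('b \<Rightarrow> real) \<Rightarrow> 'b \<Rightarrow> real" where
  "shift q \<alpha> = (\<lambda>v. cone q \<alpha> v - upper q \<alpha> v
     + (if v = c q then max 0 (\<alpha> q - sum (upper q \<alpha>) P) else 0) - (if v = q then \<alpha> q else 0))"

definition spread :: "('b \<Rightarrow> real) \<Rightarrow> 'b \<Rightarrow> real" where
  "spread \<alpha> = (\<lambda>v. \<alpha> v + (\<Sum>q\<in>bottom. shift q \<alpha> v))"

text \<open>Rescaling is necessary: if \<open>q\<close> carries mass a and the part above it mass b,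
  then \<open>spread\<close> replaces a + b by max a b.\<close>

definition retraction :: "('b \<Rightarrow> real) \<Rightarrow> 'b \<Rightarrow> real" where
  "retraction \<alpha> = (\<lambda>v. spread \<alpha> v / sum (spread \<alpha>) P)"

lemma bottomD: "q \<in> bottom \<Longrightarrow> q \<in> P - D"
  by (auto simp: bottom_def)

lemma finite_bottom: "finite bottom"
  using finite_P by (rule finite_subset[rotated]) (auto simp: bottom_def)

text \<open>Consequently a chain meets \<open>bottom\<close> in at most one point, and at most one
  of the corrections in \<open>spread\<close> is nonzero.\<close>

lemma bottom_antichain: "q \<in> bottom \<Longrightarrow> r \<in> bottom \<Longrightarrow> q \<le> r \<Longrightarrow> q = r"
  by (auto simp: bottom_def)

lemma act_bottom:
  assumes "n \<in> N" "v \<in> P" shows "act n v \<in> bottom \<longleftrightarrow> v \<in> bottom"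
proof -
  have "(\<forall>r\<in>P - D. r \<le> act n v \<longrightarrow> r = act n v) \<longleftrightarrow> (\<forall>r\<in>P - D. r \<le> v \<longrightarrow> r = v)" (is "?L \<longleftrightarrow> ?R")
  proof
    assume ?L
    show ?R
    proof (intro ballI impI)
      fix r assume r: "r \<in> P - D" "r \<le> v"
      then have "act n r \<in> P - D" "act n r \<le> act n v"
        using assms act_D act_closed act_le_iff by auto
      then have "act n r = act n v" using \<open>?L\<close> by blast
      then show "r = v" using act_inj[OF assms(1)] r assms by (auto dest: inj_onD)
    qed
  next
    assume ?R
    show ?L
    proof (intro ballI impI)
      fix r assume r: "r \<in> P - D" "r \<le> act n v"
      then obtain s where s: "s \<in> P" "r = act n s"
        using act_bij[OF assms(1)] by (auto simp: bij_betw_def)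
      then have "s \<in> P - D" "s \<le> v"
        using r assms act_D act_le_iff by auto
      then show "r = act n v" using \<open>?R\<close> s by blast
    qed
  qed
  then show ?thesis
    using assms act_D act_closed by (auto simp: bottom_def)
qed

lemma bij_act_bottom:
  assumes "n \<in> N" shows "bij_betw (act n) bottom bottom"
proof -
  have sub: "bottom \<subseteq> P" by (auto simp: bottom_def)
  have inj: "inj_on (act n) bottom" using act_inj[OF assms] sub by (rule inj_on_subset)
  have "act n ` bottom \<subseteq> bottom" using act_bottom[OF assms] sub by auto
  then have "act n ` bottom = bottom" using finite_bottom inj by (simp add: endo_inj_surj)
  with inj show ?thesis by (simp add: bij_betw_def)
qed

section \<open>The contraction above a single minimal point\<close>

context
  fixes \<alpha> :: "'b \<Rightarrow> real"
  assumes \<alpha>: "mass_on P \<alpha>"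
begin

lemma upper_mass:
  "mass_on P (upper q \<alpha>)" "0 \<le> upper q \<alpha> v" "0 \<le> sum (upper q \<alpha>) P"
  "upper q \<alpha> v \<noteq> 0 \<Longrightarrow> v \<in> P \<and> q < v"
proof -
  show m: "mass_on P (upper q \<alpha>)"
    using \<alpha> unfolding mass_on_def upper_def by (metis order.refl)
  show "0 \<le> upper q \<alpha> v" for v using m by (auto simp: mass_on_def)
  then show "0 \<le> sum (upper q \<alpha>) P" by (rule sum_nonneg)
  show "upper q \<alpha> v \<noteq> 0 \<Longrightarrow> v \<in> P \<and> q < v"
    using m by (auto simp: mass_on_def upper_def split: if_splits)
qed

text \<open>Reduces questions about \<open>cone\<close> to one slide at a time. The middle slide
  runs backwards in time, because slides lead from the larger map to the smaller one while this
  stage goes up from \<open>f q\<close> to \<open>g q\<close>.\<close>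

lemma cone_cases:
  obtains t where "cone q \<alpha> = slide P (\<lambda>w. w) (f q) t (upper q \<alpha>)"
  | t where "cone q \<alpha> = slide P (g q) (f q) t (upper q \<alpha>)"
  | t where "cone q \<alpha> = slide P (g q) (\<lambda>_. c q) t (upper q \<alpha>)"
proof -
  define u where "u = upper q \<alpha>"
  define b where "b = sum u P"
  define t where "t = 3 * \<alpha> q"
  have u0: "0 \<le> u v" for v using upper_mass unfolding u_def by simp
  have b0: "0 \<le> b" using upper_mass unfolding b_def u_def by simp
  have ce: "cone q \<alpha> = (\<lambda>v. slide P (\<lambda>w. w) (f q) t u v + (slide P (g q) (f q) (2 * b - t) u v - push P (f q) u v)
       + (slide P (g q) (\<lambda>_. c q) (t - 2 * b) u v - push P (g q) u v))"
    by (simp add: cone_def u_def b_def t_def Let_def)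
  note s = slide_start[OF u0] and e = slide_end[OF finite_P u0]
  consider "t \<le> b" | "b \<le> t" "t \<le> 2 * b" | "2 * b \<le> t" by linarith
  then show thesis
  proof cases
    case 1
    then have "cone q \<alpha> = slide P (\<lambda>w. w) (f q) t u"
      unfolding ce using b0 by (subst s[where t="t - 2 * b"], simp) (subst e[where t="2 * b - t"], auto simp: b_def)
    then show ?thesis using that unfolding u_def by blast
  next
    case 2
    then have "cone q \<alpha> = slide P (g q) (f q) (2 * b - t) u"
      unfolding ce using b0 by (subst s[where t="t - 2 * b"], simp) (subst e[where t="t"], auto simp: b_def)
    then show ?thesis using that unfolding u_def by blast
  next
    case 3
    then have "cone q \<alpha> = slide P (g q) (\<lambda>_. c q) (t - 2 * b) u"
      unfolding ce using b0 by (subst s[where t="2 * b - t"], simp) (subst e[where t="t"], auto simp: b_def)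
    then show ?thesis using that unfolding u_def by blast
  qed
qed

lemma cone_mass:
  assumes q: "q \<in> bottom"
  shows "mass_on {v\<in>P. q < v} (cone q \<alpha>)" "sum (cone q \<alpha>) P = sum (upper q \<alpha>) P"
proof -
  note qD = bottomD[OF q] and u = upper_mass[where q=q]
  have *: "v \<in> P" "q < v" "f q v \<in> P" "q < f q v" "f q v \<le> v" "g q v \<in> P" "f q v \<le> g q v" "q < g q v"
    "c q \<in> P" "q < c q" "c q \<le> g q v" if "upper q \<alpha> v \<noteq> 0" for v
    using u(4)[OF that] f_closed[OF qD, of v] g_closed[OF qD, of v] c_closed[OF qD] c_le_g[OF qD, of v]
    by auto
  have **: "f q v \<le> f q w" "g q v \<le> g q w" if "upper q \<alpha> v \<noteq> 0" "upper q \<alpha> w \<noteq> 0" "v \<le> w" for v w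
    using u(4)[OF that(1)] u(4)[OF that(2)] that(3) f_mono[OF qD] g_mono[OF qD] by auto
  show "mass_on {v\<in>P. q < v} (cone q \<alpha>)"
    by (rule cone_cases[of q]; simp only:; rule slide_mass_on[OF finite_P u(1)]) (use * ** in auto)
  show "sum (cone q \<alpha>) P = sum (upper q \<alpha>) P"
    by (rule cone_cases[of q]; simp only:; rule sum_slide[OF finite_P finite_P]) (use * in auto)
qed

text \<open>At time 0 the first stage has not begun and the other two cancel. This is what makes the
  retraction fix the points without mass on \<open>bottom\<close>.\<close>

lemma cone_eq_upper:
  assumes "\<alpha> q = 0" shows "cone q \<alpha> = upper q \<alpha>"
proof -
  note u = upper_mass[where q=q]
  have "slide P (\<lambda>w. w) (f q) 0 (upper q \<alpha>) = upper q \<alpha>"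
    by (subst slide_start[OF u(2)], simp, rule push_id[OF finite_P]) (use u(4) in blast)
  moreover have "slide P (g q) (f q) (2 * sum (upper q \<alpha>) P) (upper q \<alpha>) = push P (f q) (upper q \<alpha>)"
    by (rule slide_end[OF finite_P u(2)]) (use u(3) in simp)
  moreover have "slide P (g q) (\<lambda>_. c q) (- (2 * sum (upper q \<alpha>) P)) (upper q \<alpha>) = push P (g q) (upper q \<alpha>)"
    by (rule slide_start[OF u(2)]) (use u(3) in simp)
  ultimately show ?thesis
    using assms by (simp add: cone_def Let_def)
qed

text \<open>The origin of the factor 3 in \<open>cone\<close>: each of the three stages lasts as
  long as the mass b above \<open>q\<close>, so all are over at time 3 b, that is, when the mass at
  \<open>q\<close> reaches b.\<close>

lemma cone_concentrated:
  assumes "sum (upper q \<alpha>) P \<le> \<alpha> q" "cone q \<alpha> v \<noteq> 0"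
  shows "v = c q"
proof -
  note u = upper_mass[where q=q]
  let ?b = "sum (upper q \<alpha>) P"
  have "slide P (\<lambda>w. w) (f q) (3 * \<alpha> q) (upper q \<alpha>) = push P (f q) (upper q \<alpha>)"
    "slide P (g q) (\<lambda>_. c q) (3 * \<alpha> q - 2 * ?b) (upper q \<alpha>) = push P (\<lambda>_. c q) (upper q \<alpha>)"
    by (rule slide_end[OF finite_P u(2)]; use u(3) assms(1) in linarith)+
  moreover have "slide P (g q) (f q) (2 * ?b - 3 * \<alpha> q) (upper q \<alpha>) = push P (g q) (upper q \<alpha>)"
    by (rule slide_start[OF u(2)]) (use u(3) assms(1) in linarith)
  ultimately have "cone q \<alpha> = push P (\<lambda>_. c q) (upper q \<alpha>)"
    by (simp add: cone_def Let_def)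
  then show ?thesis using assms(2) by (cases "c q = v") (auto simp: push_def)
qed

lemma shift_eq_0: "\<alpha> q = 0 \<Longrightarrow> shift q \<alpha> v = 0"
  using upper_mass(3)[of q] by (simp add: shift_def cone_eq_upper)

lemma spread_fixed:
  assumes "\<And>q. q \<in> bottom \<Longrightarrow> \<alpha> q = 0" shows "spread \<alpha> = \<alpha>"
  unfolding spread_def using assms by (auto simp: shift_eq_0)

lemma spread_at:
  assumes q: "q \<in> bottom" "\<alpha> q \<noteq> 0"
  shows "spread \<alpha> v = (if q \<le> v then 0 else \<alpha> v) + cone q \<alpha> v
     + (if v = c q then max 0 (\<alpha> q - sum (upper q \<alpha>) P) else 0)"
proof -
  have "shift r \<alpha> v = 0" if "r \<in> bottom - {q}" for r
  proof -
    have "\<alpha> r = 0"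
      using that q \<alpha> bottom_antichain unfolding mass_on_def by (metis Diff_iff singletonI)
    then show ?thesis by (rule shift_eq_0)
  qed
  then have "(\<Sum>r\<in>bottom. shift r \<alpha> v) = shift q \<alpha> v"
    using q finite_bottom by (subst sum.remove[of _ q]) auto
  then show ?thesis
    by (auto simp: spread_def shift_def upper_def)
qed

lemma spread_mass: "mass_on (P - bottom) (spread \<alpha>)"
proof (cases "\<exists>q\<in>bottom. \<alpha> q \<noteq> 0")
  case False
  then have "spread \<alpha> = \<alpha>" by (intro spread_fixed) auto
  then show ?thesis using \<alpha> False by (auto simp: mass_on_def)
next
  case True
  then obtain q where q: "q \<in> bottom" "\<alpha> q \<noteq> 0" by blast
  note sp = spread_at[OF q] and cm = cone_mass[OF q(1)]
  let ?m = "max 0 (\<alpha> q - sum (upper q \<alpha>) P)"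
  have nn: "0 \<le> spread \<alpha> v" for v
    unfolding sp using \<alpha> cm(1) by (auto simp: mass_on_def)
  have low: "v \<in> P" "v < q" if "\<alpha> v \<noteq> 0" "\<not> q \<le> v" for v
    using that \<alpha> q(2) unfolding mass_on_def by (metis less_le_not_le)+
  define Up where "Up = {v. cone q \<alpha> v \<noteq> 0 \<or> v = c q \<and> ?m \<noteq> 0}"
  have up: "v \<in> P" "q < v" if "v \<in> Up" for v
    using that cm(1) c_closed[OF bottomD[OF q(1)]] unfolding Up_def mass_on_def by auto
  \<comment> \<open>Extra mass is put on \<open>c q\<close> only after the whole part above
    \<open>q\<close> has arrived there. Earlier, \<open>c q\<close> might be incomparable with the
    mass still in motion.\<close>
  have upch: "v \<le> w \<or> w \<le> v" if "v \<in> Up" "w \<in> Up" for v w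
  proof (cases "?m = 0")
    case True
    then show ?thesis using that cm(1) by (auto simp: Up_def mass_on_def)
  next
    case False
    then have "sum (upper q \<alpha>) P \<le> \<alpha> q" by linarith
    then have "v = c q" "w = c q" using that cone_concentrated unfolding Up_def by blast+
    then show ?thesis by simp
  qed
  \<comment> \<open>The new support consists of old points strictly below \<open>q\<close> and a
    chain strictly above \<open>q\<close>. Together they form a chain, and as both parts are
    comparable to \<open>q\<close> without containing it, they avoid the antichain
    \<open>bottom\<close>.\<close>
  have supp: "(\<alpha> v \<noteq> 0 \<and> \<not> q \<le> v) \<or> v \<in> Up" if "spread \<alpha> v \<noteq> 0" for v
    using that unfolding sp Up_def by (auto split: if_splits)
  have "v \<in> P - bottom" if "spread \<alpha> v \<noteq> 0" for v
    using supp[OF that] up[of v] low[of v] bottom_antichain[OF q(1), of v] bottom_antichain[OF _ q(1), of v]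
    by (auto simp: less_le)
  moreover have "v \<le> w \<or> w \<le> v" if "spread \<alpha> v \<noteq> 0" "spread \<alpha> w \<noteq> 0" for v w
  proof -
    have "v \<le> w \<or> w \<le> v" if "\<alpha> v \<noteq> 0" "\<alpha> w \<noteq> 0" using that \<alpha> by (auto simp: mass_on_def)
    then show ?thesis
      using supp[OF that(1)] supp[OF that(2)] upch[of v w] up[of v] up[of w] low[of v] low[of w]
      by (meson order.strict_trans less_imp_le)
  qed
  ultimately show ?thesis using nn unfolding mass_on_def by blast
qed

lemma sum_spread_pos:
  assumes "sum \<alpha> P = 1"
  shows "0 < sum (spread \<alpha>) P"
proof -
  have nn: "0 \<le> spread \<alpha> v" for v using spread_mass by (auto simp: mass_on_def)
  have "\<exists>v\<in>P. spread \<alpha> v \<noteq> 0"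
  proof (rule ccontr)
    assume "\<not> ?thesis"
    then have z: "spread \<alpha> v = 0" if "v \<in> P" for v using that by auto
    show False
    proof (cases "\<exists>q\<in>bottom. \<alpha> q \<noteq> 0")
      case False
      then have "spread \<alpha> = \<alpha>" by (intro spread_fixed) auto
      then show False using z assms by simp
    next
      case True
      then obtain q where q: "q \<in> bottom" "\<alpha> q \<noteq> 0" by blast
      note sp = spread_at[OF q] and cm = cone_mass[OF q(1)]
      have a0: "0 \<le> \<alpha> v" and c0: "0 \<le> cone q \<alpha> v" for v using \<alpha> cm(1) by (auto simp: mass_on_def)
      have cz: "cone q \<alpha> v = 0" if "v \<in> P" for v
        using z[OF that] a0[of v] c0[of v] unfolding sp by (auto split: if_splits)
      \<comment> \<open>With no mass above \<open>q\<close>, the excess placed on \<open>c q\<close>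
        is all of \<open>\<alpha> q\<close>, which is positive.\<close>
      then have "sum (upper q \<alpha>) P = 0" using cm(2) by simp
      moreover have "c q \<in> P" "q < c q" using c_closed[OF bottomD[OF q(1)]] by auto
      ultimately show False
        using z[of "c q"] cz[of "c q"] q(2) a0[of q] unfolding sp by (auto split: if_splits simp: less_le)
    qed
  qed
  then obtain v where v: "v \<in> P" "spread \<alpha> v \<noteq> 0" by blast
  have "0 < spread \<alpha> v" using nn[of v] v(2) by linarith
  then show ?thesis by (rule sum_pos2[OF finite_P v(1)]) (rule nn)
qed

end

lemma retraction_points:
  assumes "\<alpha> \<in> points"
  shows "retraction \<alpha> \<in> realization_points (order_complex (P - bottom))"
proof -
  have a: "mass_on P \<alpha>" "sum \<alpha> P = 1" using assms finite_P by (auto simp: realization_points_iff)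
  note m = spread_mass[OF a(1)] and p = sum_spread_pos[OF a]
  have "mass_on (P - bottom) (retraction \<alpha>)"
    using m p unfolding mass_on_def retraction_def by simp
  moreover have "sum (retraction \<alpha>) (P - bottom) = 1"
  proof -
    have "sum (spread \<alpha>) (P - bottom) = sum (spread \<alpha>) P"
      using m finite_P by (intro sum.mono_neutral_left) (auto simp: mass_on_def)
    then show ?thesis using p by (simp add: retraction_def flip: sum_divide_distrib)
  qed
  ultimately show ?thesis using finite_P by (simp add: realization_points_iff)
qed

lemma retraction_fixed:
  assumes "\<alpha> \<in> realization_points (order_complex (P - bottom))"
  shows "retraction \<alpha> = \<alpha>"
proof -
  have a: "mass_on (P - bottom) \<alpha>" "sum \<alpha> (P - bottom) = 1"
    using assms finite_P by (auto simp: realization_points_iff)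
  then have m: "mass_on P \<alpha>" by (auto simp: mass_on_def)
  have s: "spread \<alpha> = \<alpha>" by (rule spread_fixed[OF m]) (use a in \<open>auto simp: mass_on_def\<close>)
  have "sum \<alpha> P = sum \<alpha> (P - bottom)"
    using a finite_P by (intro sum.mono_neutral_right) (auto simp: mass_on_def)
  then show ?thesis using a s by (simp add: retraction_def)
qed

lemma continuous_spread: "continuous_on S (\<lambda>\<alpha>. spread \<alpha> v)"
proof -
  have p: "continuous_on S (\<lambda>\<alpha>. \<alpha> w)" for w :: 'b and S :: "('b \<Rightarrow> real) set"
    by (rule continuous_on_subset[OF continuous_on_product_coordinates]) simp
  have u: "continuous_on S (\<lambda>\<alpha>. upper q \<alpha> w)" for q w
    unfolding upper_def by (intro continuous_on_const_if p)
  have b: "continuous_on S (\<lambda>\<alpha>. sum (upper q \<alpha>) P)" for q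
    by (intro continuous_intros u)
  have sl: "continuous_on S (\<lambda>\<alpha>. slide P F G (T \<alpha>) (upper q \<alpha>) v)"
    if "continuous_on S T" for T q and F G :: "'b \<Rightarrow> 'b"
    by (rule continuous_slide[where t=T and u="upper q"]; rule that u)
  have pu: "continuous_on S (\<lambda>\<alpha>. push P F (upper q \<alpha>) v)" for q and F :: "'b \<Rightarrow> 'b"
    by (rule continuous_push[where u="upper q"]; rule u)
  have co: "continuous_on S (\<lambda>\<alpha>. cone q \<alpha> v)" for q
    unfolding cone_def Let_def
    by (intro continuous_on_add continuous_on_diff sl[where q=q] pu[where q=q] continuous_on_mult
        continuous_on_const p b)
  show ?thesis
    unfolding spread_def shift_def
    by (intro continuous_on_add continuous_on_diff continuous_on_sum continuous_on_const_if
        continuous_on_max continuous_on_const co p u b)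
qed

lemma continuous_retraction: "continuous_on points retraction"
proof (rule continuous_on_coordinatewise_then_product)
  fix v
  have "sum (spread \<alpha>) P \<noteq> 0" if "\<alpha> \<in> points" for \<alpha>
    using sum_spread_pos[of \<alpha>] that finite_P by (auto simp: realization_points_iff)
  then show "continuous_on points (\<lambda>\<alpha>. retraction \<alpha> v)"
    unfolding retraction_def by (intro continuous_intros continuous_spread) auto
qed

section \<open>Equivariance of the retraction\<close>

lemma push_off: "n \<in> N \<Longrightarrow> v \<notin> P \<Longrightarrow> push P (act n) u v = 0"
  unfolding push_def using act_closed by (intro sum.neutral) auto

lemma push_act_at: "n \<in> N \<Longrightarrow> w \<in> P \<Longrightarrow> push P (act n) u (act n w) = u w"
  by (intro push_at finite_P act_inj)

text \<open>The maps on the two sides differ: \<open>F'\<close> and \<open>G'\<close> are those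
  attached to \<open>act n q\<close>, whereas \<open>F\<close> and \<open>G\<close> are those
  attached to \<open>q\<close>.\<close>

lemma slide_act_at:
  assumes n: "n \<in> N" and w: "w \<in> P"
    and F: "\<And>x. u x \<noteq> 0 \<Longrightarrow> x \<in> P \<Longrightarrow> F' (act n x) = act n (F x) \<and> F x \<in> P"
    and G: "\<And>x. u x \<noteq> 0 \<Longrightarrow> x \<in> P \<Longrightarrow> G' (act n x) = act n (G x) \<and> G x \<in> P"
  shows "slide P F' G' t (push P (act n) u) (act n w) = slide P F G t u w"
proof -
  have "slide P F' G' t (push P (act n) u) = slide P (F' \<circ> act n) (G' \<circ> act n) t u"
    by (rule slide_push[OF finite_P act_bij[OF n] act_less_iff[OF n]])
  also have "\<dots> = slide P (act n \<circ> F) (act n \<circ> G) t u"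
    by (rule slide_cong) (use F G in auto)
  also have "\<dots> = push P (act n) (slide P F G t u)"
    by (rule push_slide[symmetric]) (use F G finite_P in auto)
  finally show ?thesis using n w by (simp add: push_act_at)
qed

lemma push_map_act_at:
  assumes n: "n \<in> N" and w: "w \<in> P"
    and F: "\<And>x. u x \<noteq> 0 \<Longrightarrow> x \<in> P \<Longrightarrow> F' (act n x) = act n (F x) \<and> F x \<in> P"
  shows "push P F' (push P (act n) u) (act n w) = push P F u w"
proof -
  have "push P F' (push P (act n) u) = push P (F' \<circ> act n) u"
    using act_closed[OF n] by (intro push_push finite_P)
  also have "\<dots> = push P (act n \<circ> F) u"
    by (rule push_cong) (use F in auto)
  also have "\<dots> = push P (act n) (push P F u)"
    by (rule push_push[symmetric]) (use F finite_P in auto)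
  finally show ?thesis using n w by (simp add: push_act_at)
qed

lemma act_eq_iff: "n \<in> N \<Longrightarrow> v \<in> P \<Longrightarrow> w \<in> P \<Longrightarrow> act n v = act n w \<longleftrightarrow> v = w"
  using act_inj by (auto dest: inj_onD)

text \<open>A group element carries the correction at \<open>q\<close> to the correction at
  \<open>act n q\<close>. It permutes \<open>bottom\<close>, so the sum of all corrections and the
  normalizing total are preserved.\<close>

lemma retraction_act:
  assumes n: "n \<in> N" and \<alpha>: "\<alpha> \<in> points"
  shows "retraction (push P (act n) \<alpha>) = push P (act n) (retraction \<alpha>)"
proof -
  let ?\<beta> = "push P (act n) \<alpha>"
  have a: "mass_on P \<alpha>" using \<alpha> finite_P by (auto simp: realization_points_iff)
  have \<beta>: "?\<beta> \<in> points" using act_points[OF n \<alpha>] by simp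
  have b: "mass_on P ?\<beta>" using \<beta> finite_P by (auto simp: realization_points_iff)
  have at: "?\<beta> (act n w) = \<alpha> w" if "w \<in> P" for w using n that by (rule push_act_at)
  have up: "upper (act n q) ?\<beta> = push P (act n) (upper q \<alpha>)" if "q \<in> P" for q
  proof
    fix v
    show "upper (act n q) ?\<beta> v = push P (act n) (upper q \<alpha>) v"
    proof (cases "v \<in> P")
      case True
      then obtain w where "w \<in> P" "v = act n w"
        using act_bij[OF n] by (auto simp: bij_betw_def)
      then show ?thesis
        using n that by (simp add: upper_def push_act_at act_less_iff)
    next
      case False
      then show ?thesis using n by (simp add: upper_def push_off)
    qed
  qed
  have mass: "sum (upper (act n q) ?\<beta>) P = sum (upper q \<alpha>) P" if "q \<in> P" for q
    unfolding up[OF that] using act_closed[OF n] by (intro sum_push finite_P)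
  have cone: "cone (act n q) ?\<beta> (act n w) = cone q \<alpha> w" if q: "q \<in> bottom" and w: "w \<in> P" for q w
  proof -
    note qD = bottomD[OF q]
    have *: "x \<in> P \<and> q < x" if "upper q \<alpha> x \<noteq> 0" for x by (rule upper_mass(4)[OF a that])
    have F: "f (act n q) (act n x) = act n (f q x) \<and> f q x \<in> P" and G: "g (act n q) (act n x) = act n (g q x) \<and> g q x \<in> P"
      if "upper q \<alpha> x \<noteq> 0" for x
      using *[OF that] f_act[OF n qD] g_act[OF n qD] f_closed[OF qD] g_closed[OF qD] by auto
    have C: "c (act n q) = act n (c q)" "c q \<in> P" using c_act[OF n qD] c_closed[OF qD] by auto
    have qP: "q \<in> P" using qD by blast
    show ?thesis
      unfolding cone_def Let_def mass[OF qP] at[OF qP] unfolding up[OF qP]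
      by (intro arg_cong2[where f="(+)"] arg_cong2[where f="(-)"] slide_act_at[OF n w] push_map_act_at[OF n w])
         (use F G C in auto)
  qed
  have shift: "shift (act n q) ?\<beta> (act n w) = shift q \<alpha> w" if q: "q \<in> bottom" and w: "w \<in> P" for q w
  proof -
    note qD = bottomD[OF q]
    have qP: "q \<in> P" and C: "c (act n q) = act n (c q)" "c q \<in> P"
      using qD c_act[OF n qD] c_closed[OF qD] by auto
    show ?thesis
      unfolding shift_def cone[OF that] mass[OF qP] at[OF qP] unfolding up[OF qP] C(1)
      using n w qP C(2) by (simp add: act_eq_iff push_act_at)
  qed
  have spread: "spread ?\<beta> (act n w) = spread \<alpha> w" if w: "w \<in> P" for w
  proof -
    have "(\<Sum>q\<in>bottom. shift q ?\<beta> (act n w)) = (\<Sum>q\<in>bottom. shift (act n q) ?\<beta> (act n w))"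
      by (rule sum.reindex_bij_betw[OF bij_act_bottom[OF n], symmetric])
    then show ?thesis using w by (simp add: spread_def at shift)
  qed
  have total: "sum (spread ?\<beta>) P = sum (spread \<alpha>) P"
  proof -
    have "sum (spread ?\<beta>) P = (\<Sum>w\<in>P. spread ?\<beta> (act n w))"
      by (rule sum.reindex_bij_betw[OF act_bij[OF n], symmetric])
    then show ?thesis by (simp add: spread)
  qed
  show ?thesis
  proof
    fix v
    show "retraction ?\<beta> v = push P (act n) (retraction \<alpha>) v"
    proof (cases "v \<in> P")
      case True
      then obtain w where "w \<in> P" "v = act n w"
        using act_bij[OF n] by (auto simp: bij_betw_def)
      then show ?thesis
        using n by (simp add: push_act_at retraction_def total spread)
    next
      case False
      then have "retraction ?\<beta> v = 0"
        using retraction_points[OF \<beta>] finite_P by (auto simp: realization_points_iff mass_on_def)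
      then show ?thesis using n False by (simp add: push_off)
    qed
  qed
qed

text \<open>A point strictly above a member of \<open>P - D\<close> is not minimal in
  \<open>P - D\<close>, hence not in \<open>bottom\<close>. So all values of \<open>f\<close>,
  \<open>g\<close> and \<open>c\<close> survive the removal.\<close>

lemma conical_above_minus_bottom: "conical_above N (P - bottom) act D f g c"
proof -
  have a: "finite_poset_action N (P - bottom) act"
    by (rule action_subset) (use act_bottom act_closed in auto)
  have up: "v \<in> P - bottom" if "q \<in> P - D" "v \<in> P" "q < v" for q v
  proof -
    have "v \<notin> bottom"
    proof
      assume "v \<in> bottom"
      then have "q = v" using that(1,3) by (simp add: bottom_def)
      then show False using that(3) by simp
    qed
    then show ?thesis using that(2) by simp
  qed
  show ?thesis
  proof (rule conical_above.intro[OF a], rule conical_above_axioms.intro)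
    show "D \<subseteq> P - bottom" using D_subset by (auto simp: bottom_def)
    fix q v assume q: "q \<in> P - bottom - D" and v: "v \<in> P - bottom" "q < v"
    show "f q v \<in> P - bottom \<and> q < f q v \<and> f q v \<le> v"
      using f_closed[of q v] up[of q "f q v"] q v by auto
    show "g q v \<in> P - bottom \<and> f q v \<le> g q v"
      using f_closed[of q v] g_closed[of q v] up[of q "g q v"] order.strict_trans2[of q "f q v" "g q v"] q v
      by auto
  next
    fix q assume "q \<in> P - bottom - D"
    then show "c q \<in> P - bottom \<and> q < c q" using c_closed[of q] up[of q "c q"] by auto
  next
    fix n v show "n \<in> N \<Longrightarrow> v \<in> P - bottom \<Longrightarrow> (act n v \<in> D) = (v \<in> D)"
      by (simp add: act_D)
  next
    fix q v w assume "q \<in> P - bottom - D" "v \<in> P - bottom" "w \<in> P - bottom" "q < v" "v \<le> w"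
    then show "f q v \<le> f q w" "g q v \<le> g q w"
      by (simp_all add: f_mono g_mono)
  next
    fix n q v assume "n \<in> N" "q \<in> P - bottom - D" "v \<in> P - bottom" "q < v"
    then show "f (act n q) (act n v) = act n (f q v)" "g (act n q) (act n v) = act n (g q v)"
      by (simp_all add: f_act g_act)
  next
    fix n q assume "n \<in> N" "q \<in> P - bottom - D"
    then show "c (act n q) = act n (c q)" by (simp add: c_act)
  next
    fix q v assume "q \<in> P - bottom - D" "v \<in> P - bottom" "q < v"
    then show "c q \<le> g q v" by (simp add: c_le_g)
  qed
qed

lemma retraction_step:
  "continuous_map (realization (order_complex P)) (realization (order_complex (P - bottom))) retraction"
  "equivariant N (realization (order_complex P)) (\<lambda>n. affine_extension (act n))
     (\<lambda>n. affine_extension (act n)) retraction"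
proof -
  show "continuous_map (realization (order_complex P)) (realization (order_complex (P - bottom))) retraction"
    unfolding realization_def using continuous_retraction retraction_points by auto
  have "retraction (affine_extension (act n) \<alpha>) = affine_extension (act n) (retraction \<alpha>)"
    if "n \<in> N" "\<alpha> \<in> points" for n \<alpha>
  proof -
    have "affine_extension (act n) (retraction \<alpha>) = push P (act n) (retraction \<alpha>)"
      using retraction_points[OF that(2)] finite_P
      by (intro affine_extension_eq_push) (auto simp: realization_points_iff mass_on_def)
    then show ?thesis using that by (simp add: act_points retraction_act)
  qed
  then show "equivariant N (realization (order_complex P)) (\<lambda>n. affine_extension (act n))
     (\<lambda>n. affine_extension (act n)) retraction"
    by (simp add: equivariant_def)
qed

end

section \<open>Iterated removal and contractibility of the retract\<close>

lemma equivariant_retraction: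
  assumes "conical_above N P act D f g c"
  shows "\<exists>r. continuous_map (realization (order_complex P)) (realization (order_complex D)) r \<and>
    equivariant N (realization (order_complex P)) (\<lambda>n. affine_extension (act n))
      (\<lambda>n. affine_extension (act n)) r \<and>
    (\<forall>\<alpha>\<in>realization_points (order_complex D). r \<alpha> = \<alpha>)"
  using assms
proof (induction "card (P - D)" arbitrary: P rule: less_induct)
  case less
  interpret conical_above N P act D f g c by fact
  show ?case
  proof (cases "P = D")
    case True
    then show ?thesis by (intro exI[of _ "\<lambda>\<alpha>. \<alpha>"]) (auto simp: equivariant_def)
  next
    case False
    then have ne: "P - D \<noteq> {}" using D_subset by auto
    then obtain q where q: "q \<in> P - D" "\<And>r. r \<in> P - D \<Longrightarrow> r \<le> q \<Longrightarrow> r = q"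
      using finite_has_minimal[OF finite_Diff[OF finite_P] ne] by metis
    then have "q \<in> bottom" by (auto simp: bottom_def)
    then have "card (P - bottom - D) < card (P - D)"
      using q finite_P by (intro psubset_card_mono) auto
    from less.hyps[OF this conical_above_minus_bottom]
    obtain r where r: "continuous_map (realization (order_complex (P - bottom))) (realization (order_complex D)) r"
      "equivariant N (realization (order_complex (P - bottom))) (\<lambda>n. affine_extension (act n))
      (\<lambda>n. affine_extension (act n)) r"
      "\<forall>\<alpha>\<in>realization_points (order_complex D). r \<alpha> = \<alpha>" by blast
    have sub: "\<alpha> \<in> realization_points (order_complex (P - bottom))"
      if "\<alpha> \<in> realization_points (order_complex D)" for \<alpha>
      using that D_subset
      unfolding realization_points_def order_complex_def bottom_def by auto
    show ?thesis
    proof (intro exI[of _ "r \<circ> retraction"] conjI ballI)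
      show "continuous_map (realization (order_complex P)) (realization (order_complex D)) (r \<circ> retraction)"
        using retraction_step(1) r(1) by (rule continuous_map_compose)
      show "equivariant N (realization (order_complex P)) (\<lambda>n. affine_extension (act n))
        (\<lambda>n. affine_extension (act n)) (r \<circ> retraction)"
        using retraction_step(2) r(2) retraction_points by (simp add: equivariant_def)
    qed (use r(3) sub retraction_fixed in auto)
  qed
qed

lemma equivariantly_contractibleI:
  assumes h: "homotopic_with (equivariant N X \<phi> \<phi>) X X id (\<lambda>_. x0)"
    and x0: "x0 \<in> topspace X" "\<And>n. n \<in> N \<Longrightarrow> \<phi> n x0 = x0"
  shows "equivariantly_contractible N X \<phi>"
  unfolding equivariantly_contractible_def equivariantly_homotopy_equivalent_def
proof (intro exI conjI)
  let ?U = "discrete_topology {()}"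
  show "continuous_map X ?U (\<lambda>_. ())" by simp
  show "equivariant N X \<phi> (\<lambda>_. id) (\<lambda>_. ())" by (simp add: equivariant_def)
  show "continuous_map ?U X (\<lambda>_. x0)" using x0(1) by simp
  show "equivariant N ?U (\<lambda>_. id) \<phi> (\<lambda>_. x0)" using x0(2) by (simp add: equivariant_def)
  show "homotopic_with (equivariant N X \<phi> \<phi>) X X ((\<lambda>_. x0) \<circ> (\<lambda>_. ())) id"
    using h by (simp add: homotopic_with_sym comp_def)
  have "(\<lambda>_. ()) \<circ> (\<lambda>_::unit. x0) = id" by auto
  then show "homotopic_with (equivariant N ?U (\<lambda>_. id) (\<lambda>_. id)) ?U ?U ((\<lambda>_. ()) \<circ> (\<lambda>_. x0)) id"
    by (simp add: equivariant_def)
qed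

text \<open>The vertex \<open>x0\<close> belongs to \<open>S\<close> and possibly not to
  \<open>D\<close>. The contraction therefore ends at the image of this vertex under the retraction,
  a fixed point of |D| that may be no vertex.\<close>

lemma contractible_via_retract:
  fixes S D :: "'v::order set" and act :: "'g \<Rightarrow> 'v \<Rightarrow> 'v"
  assumes cone: "conical_above N S act D f g c"
    and x0: "x0 \<in> S" "\<And>n. n \<in> N \<Longrightarrow> act n x0 = x0"
    and null: "homotopic_with (equivariant N (realization (order_complex D))
        (\<lambda>n. affine_extension (act n)) (\<lambda>n. affine_extension (act n)))
       (realization (order_complex D)) (realization (order_complex S))
       (affine_extension (\<lambda>v. v)) (affine_extension (\<lambda>_. x0))"
  shows "poset_equivariantly_contractible N D act"
proof -
  interpret conical_above N S act D f g c by fact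
  let ?X = "realization (order_complex D)" and ?Y = "realization (order_complex S)"
  let ?\<phi> = "\<lambda>n. affine_extension (act n)"
  interpret D: finite_poset_action N D act
    using act_D D_subset by (intro action_subset) auto
  obtain r where r: "continuous_map ?Y ?X r" "equivariant N ?Y ?\<phi> ?\<phi> r"
    "\<And>\<alpha>. \<alpha> \<in> D.points \<Longrightarrow> r \<alpha> = \<alpha>"
    using equivariant_retraction[OF cone] by blast
  define \<delta> where "\<delta> = (\<lambda>v. if v = x0 then 1 else 0 :: real)"
  have \<delta>: "\<delta> \<in> points"
    using finite_P x0(1) by (auto simp: realization_points_iff mass_on_def \<delta>_def)
  have act\<delta>: "?\<phi> n \<delta> = \<delta>" if "n \<in> N" for n
  proof -
    have "?\<phi> n \<delta> = push S (act n) \<delta>" using that \<delta> by (rule act_points(1))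
    also have "\<dots> = push S (\<lambda>v. v) \<delta>" using x0(2)[OF that] by (intro push_cong) (auto simp: \<delta>_def split: if_splits)
    also have "\<dots> = \<delta>" using finite_P x0(1) by (intro push_id) (auto simp: \<delta>_def split: if_splits)
    finally show ?thesis .
  qed
  have m: "mass_on D \<alpha>" "sum \<alpha> D = 1" "\<And>v. \<alpha> v \<noteq> 0 \<Longrightarrow> v \<in> D" if "\<alpha> \<in> D.points" for \<alpha>
    using that D.finite_P by (auto simp: realization_points_iff mass_on_def)
  have idD: "affine_extension (\<lambda>v. v) \<alpha> = \<alpha>" if "\<alpha> \<in> D.points" for \<alpha>
  proof -
    have "affine_extension (\<lambda>v. v) \<alpha> = push D (\<lambda>v. v) \<alpha>"
      using m(3)[OF that] D.finite_P by (rule affine_extension_eq_push[rotated])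
    also have "\<dots> = \<alpha>" using D.finite_P m(3)[OF that] by (rule push_id)
    finally show ?thesis .
  qed
  have constD: "affine_extension (\<lambda>_. x0) \<alpha> = \<delta>" if "\<alpha> \<in> D.points" for \<alpha>
  proof -
    have "affine_extension (\<lambda>_. x0) \<alpha> = push D (\<lambda>_. x0) \<alpha>"
      using m(3)[OF that] D.finite_P by (rule affine_extension_eq_push[rotated])
    also have "\<dots> = \<delta>" using m(2)[OF that] by (auto simp: push_def \<delta>_def)
    finally show ?thesis .
  qed
  \<comment> \<open>Continuity joins the property so that each intermediate map is known to take
    values in |S|, the only place where \<open>r\<close> is known to be equivariant.\<close>
  have "homotopic_with (\<lambda>h. continuous_map ?X ?Y h \<and> equivariant N ?X ?\<phi> ?\<phi> h) ?X ?Y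
      (affine_extension (\<lambda>v. v)) (affine_extension (\<lambda>_. x0))"
    using null by (rule homotopic_with_mono) auto
  then have "homotopic_with (equivariant N ?X ?\<phi> ?\<phi>) ?X ?X
      (r \<circ> affine_extension (\<lambda>v. v)) (r \<circ> affine_extension (\<lambda>_. x0))"
  proof (rule homotopic_with_compose_continuous_map_left[OF _ r(1)])
    fix h assume h: "continuous_map ?X ?Y h \<and> equivariant N ?X ?\<phi> ?\<phi> h"
    then have "h \<alpha> \<in> topspace ?Y" if "\<alpha> \<in> topspace ?X" for \<alpha>
      using that by (auto simp: continuous_map_def)
    with h r(2) show "equivariant N ?X ?\<phi> ?\<phi> (r \<circ> h)"
      by (simp add: equivariant_def)
  qed
  then have "homotopic_with (equivariant N ?X ?\<phi> ?\<phi>) ?X ?X id (\<lambda>_. r \<delta>)"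
  proof (rule homotopic_with_eq)
    show "id \<alpha> = (r \<circ> affine_extension (\<lambda>v. v)) \<alpha>" if "\<alpha> \<in> topspace ?X" for \<alpha>
      using that by (simp add: idD r(3))
    show "r \<delta> = (r \<circ> affine_extension (\<lambda>_. x0)) \<alpha>" if "\<alpha> \<in> topspace ?X" for \<alpha>
      using that by (simp add: constD)
    show "equivariant N ?X ?\<phi> ?\<phi> h = equivariant N ?X ?\<phi> ?\<phi> k"
      if "\<And>x. x \<in> topspace ?X \<Longrightarrow> h x = k x" for h k
      using that D.act_points by (simp add: equivariant_def)
  qed
  then show ?thesis
    unfolding poset_equivariantly_contractible_def
  proof (rule equivariantly_contractibleI)
    show "r \<delta> \<in> topspace ?X" using r(1) \<delta> by (auto simp: continuous_map_def)
    show "?\<phi> n (r \<delta>) = r \<delta>" if "n \<in> N" for n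
      using r(2) \<delta> act\<delta>[OF that] that by (simp add: equivariant_def) metis
  qed
qed

section \<open>Conjugation and \<open>p\<close>-subgroups\<close>

context group
begin

definition cj :: "'a \<Rightarrow> 'a \<Rightarrow> 'a" where
  "cj g x = g \<otimes> x \<otimes> inv g"

lemma cj_closed [simp, intro]: "g \<in> carrier G \<Longrightarrow> x \<in> carrier G \<Longrightarrow> cj g x \<in> carrier G"
  by (simp add: cj_def)

lemma cj_one_left [simp]: "x \<in> carrier G \<Longrightarrow> cj \<one> x = x"
  by (simp add: cj_def)

lemma cj_one_right [simp]: "g \<in> carrier G \<Longrightarrow> cj g \<one> = \<one>"
  by (simp add: cj_def)

lemma cj_mult_right:
  "g \<in> carrier G \<Longrightarrow> x \<in> carrier G \<Longrightarrow> y \<in> carrier G \<Longrightarrow> cj g (x \<otimes> y) = cj g x \<otimes> cj g y"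
proof -
  assume c: "g \<in> carrier G" "x \<in> carrier G" "y \<in> carrier G"
  then have "inv g \<otimes> (g \<otimes> (y \<otimes> inv g)) = y \<otimes> inv g"
    by (metis inv_closed l_inv l_one m_assoc m_closed)
  with c show ?thesis by (simp add: cj_def m_assoc)
qed

lemma cj_mult_left:
  "g \<in> carrier G \<Longrightarrow> h \<in> carrier G \<Longrightarrow> x \<in> carrier G \<Longrightarrow> cj (g \<otimes> h) x = cj g (cj h x)"
  unfolding cj_def by (simp add: m_assoc inv_mult_group)

lemma cj_cj_inv [simp]: "g \<in> carrier G \<Longrightarrow> x \<in> carrier G \<Longrightarrow> cj g (cj (inv g) x) = x"
  by (simp flip: cj_mult_left)

lemma cj_inv_cj [simp]: "g \<in> carrier G \<Longrightarrow> x \<in> carrier G \<Longrightarrow> cj (inv g) (cj g x) = x"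
  by (simp flip: cj_mult_left)

lemma cj_inv_right: "g \<in> carrier G \<Longrightarrow> x \<in> carrier G \<Longrightarrow> cj g (inv x) = inv (cj g x)"
  by (simp add: cj_def inv_mult_group m_assoc)

lemma cj_pow: "g \<in> carrier G \<Longrightarrow> x \<in> carrier G \<Longrightarrow> cj g (x [^] (n::nat)) = cj g x [^] n"
  by (induction n) (simp_all add: cj_mult_right)

lemma cj_eq_iff: "g \<in> carrier G \<Longrightarrow> x \<in> carrier G \<Longrightarrow> y \<in> carrier G \<Longrightarrow> cj g x = cj g y \<longleftrightarrow> x = y"
  by (metis cj_inv_cj)

lemma cj_fix_iff: "g \<in> carrier G \<Longrightarrow> x \<in> carrier G \<Longrightarrow> cj g x = x \<longleftrightarrow> g \<otimes> x = x \<otimes> g"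
  unfolding cj_def by (metis inv_solve_right m_closed)

lemma cj_commute: "g \<in> carrier G \<Longrightarrow> x \<in> carrier G \<Longrightarrow> g \<otimes> x = x \<otimes> g \<Longrightarrow> cj g x = x"
  by (simp add: cj_fix_iff)

lemma inj_on_cj: "g \<in> carrier G \<Longrightarrow> inj_on (cj g) (carrier G)"
  by (rule inj_onI) (simp add: cj_eq_iff)

lemma cj_image_mult: "g \<in> carrier G \<Longrightarrow> h \<in> carrier G \<Longrightarrow> A \<subseteq> carrier G \<Longrightarrow> cj (g \<otimes> h) ` A = cj g ` cj h ` A"
  unfolding image_image by (intro image_cong refl) (auto simp: cj_mult_left)

lemma cj_inv_image [simp]:
  assumes "g \<in> carrier G" "A \<subseteq> carrier G" shows "cj (inv g) ` cj g ` A = A"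
proof -
  have "cj (inv g) (cj g x) = x" if "x \<in> A" for x using that assms by (auto intro: cj_inv_cj)
  then show ?thesis by (simp add: image_image)
qed

lemma cj_image_inv [simp]:
  assumes "g \<in> carrier G" "A \<subseteq> carrier G" shows "cj g ` cj (inv g) ` A = A"
proof -
  have "cj g (cj (inv g) x) = x" if "x \<in> A" for x using that assms by (auto intro: cj_cj_inv)
  then show ?thesis by (simp add: image_image)
qed

lemma cj_image_subset: "g \<in> carrier G \<Longrightarrow> A \<subseteq> carrier G \<Longrightarrow> cj g ` A \<subseteq> carrier G"
  by auto

lemma conjugate_eq: "g \<in> carrier G \<Longrightarrow> A \<subseteq> carrier G \<Longrightarrow> conjugate G g A = cj g ` A"
  unfolding conjugate_def cj_def l_coset_def r_coset_def by auto

lemma cj_mem_iff: "g \<in> carrier G \<Longrightarrow> x \<in> carrier G \<Longrightarrow> A \<subseteq> carrier G \<Longrightarrow> cj g x \<in> cj g ` A \<longleftrightarrow> x \<in> A"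
  by (auto simp: cj_eq_iff subset_iff)

lemma mem_cj_image_iff: "g \<in> carrier G \<Longrightarrow> x \<in> carrier G \<Longrightarrow> A \<subseteq> carrier G \<Longrightarrow> x \<in> cj g ` A \<longleftrightarrow> cj (inv g) x \<in> A"
  by (metis cj_cj_inv cj_closed cj_mem_iff inv_closed)

lemma subgroup_cj_image:
  assumes "subgroup H G" "g \<in> carrier G" shows "subgroup (cj g ` H) G"
proof (rule subgroupI)
  note sub = subgroup.subset[OF assms(1)]
  show "cj g ` H \<subseteq> carrier G" using sub assms by auto
  show "cj g ` H \<noteq> {}" using subgroup.one_closed[OF assms(1)] by auto
  show "inv a \<in> cj g ` H" if "a \<in> cj g ` H" for a
    using that sub assms subgroup.m_inv_closed[OF assms(1)] by (auto simp flip: cj_inv_right)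
  show "a \<otimes> b \<in> cj g ` H" if ab: "a \<in> cj g ` H" "b \<in> cj g ` H" for a b
  proof -
    obtain x y where "x \<in> H" "y \<in> H" "a = cj g x" "b = cj g y" using ab by auto
    moreover from this have "cj g (x \<otimes> y) = a \<otimes> b" using sub assms by (auto intro: cj_mult_right)
    ultimately show ?thesis using subgroup.m_closed[OF assms(1)] by (metis imageI)
  qed
qed

lemma card_cj_image: "g \<in> carrier G \<Longrightarrow> A \<subseteq> carrier G \<Longrightarrow> card (cj g ` A) = card A"
  using inj_on_cj inj_on_subset by (blast intro: card_image)

lemma normalizer_iff:
  "A \<subseteq> carrier G \<Longrightarrow> g \<in> normalizer G A \<longleftrightarrow> g \<in> carrier G \<and> cj g ` A = A"
  unfolding normalizer_def stabilizer_def using conjugate_eq by (auto simp: conjugate_def)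

text \<open>An injective map of a finite set into itself is onto, so one inclusion suffices.\<close>

lemma normalizer_subgroup_iff:
  assumes "finite (carrier G)" "A \<subseteq> carrier G"
  shows "g \<in> normalizer G A \<longleftrightarrow> g \<in> carrier G \<and> (\<forall>x\<in>A. cj g x \<in> A)"
proof -
  have "finite A" using assms finite_subset by blast
  moreover have "inj_on (cj g) A" if "g \<in> carrier G" using inj_on_cj[OF that] assms inj_on_subset by blast
  ultimately show ?thesis
    using endo_inj_surj[of A "cj g"] unfolding normalizer_iff[OF assms(2)] by blast
qed

lemma subgroup_centralizer:
  assumes "A \<subseteq> carrier G" shows "subgroup (centralizer G A) G"
proof (rule subgroupI)
  show "centralizer G A \<noteq> {}" using assms by (auto simp: centralizer_def intro!: exI[of _ \<one>])
next
  fix a assume a: "a \<in> centralizer G A"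
  have "inv a \<otimes> s = s \<otimes> inv a" if "s \<in> A" for s
  proof -
    have "a \<in> carrier G" "s \<in> carrier G" "a \<otimes> s = s \<otimes> a" using a that assms by (auto simp: centralizer_def)
    then show ?thesis by (metis inv_closed inv_solve_left inv_solve_right m_assoc m_closed)
  qed
  then show "inv a \<in> centralizer G A" using a by (auto simp: centralizer_def)
next
  fix a b assume a: "a \<in> centralizer G A" "b \<in> centralizer G A"
  have "a \<otimes> b \<otimes> s = s \<otimes> (a \<otimes> b)" if "s \<in> A" for s
  proof -
    have "a \<in> carrier G" "b \<in> carrier G" "s \<in> carrier G" "a \<otimes> s = s \<otimes> a" "b \<otimes> s = s \<otimes> b"
      using a that assms by (auto simp: centralizer_def)
    then show ?thesis by (metis m_assoc)
  qed
  then show "a \<otimes> b \<in> centralizer G A" using a by (auto simp: centralizer_def)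
qed (auto simp: centralizer_def)

lemma centralizer_cj:
  assumes "g \<in> carrier G" "A \<subseteq> carrier G"
  shows "centralizer G (cj g ` A) = cj g ` centralizer G A"
proof -
  have *: "cj g ` centralizer G A \<subseteq> centralizer G (cj g ` A)" if "g \<in> carrier G" "A \<subseteq> carrier G" for g A
  proof
    fix y assume "y \<in> cj g ` centralizer G A"
    then obtain x where x: "x \<in> carrier G" "\<And>s. s \<in> A \<Longrightarrow> x \<otimes> s = s \<otimes> x" "y = cj g x"
      by (auto simp: centralizer_def)
    have "y \<otimes> cj g s = cj g s \<otimes> y" if "s \<in> A" for s
      using x(2)[OF that] x(1,3) that \<open>g \<in> carrier G\<close> \<open>A \<subseteq> carrier G\<close>
      by (metis cj_mult_right subsetD)
    then show "y \<in> centralizer G (cj g ` A)" using x that by (auto simp: centralizer_def)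
  qed
  have "cj (inv g) ` centralizer G (cj g ` A) \<subseteq> centralizer G A"
    using *[of "inv g" "cj g ` A"] assms by (simp add: cj_image_subset)
  then have "cj g ` cj (inv g) ` centralizer G (cj g ` A) \<subseteq> cj g ` centralizer G A" by (rule image_mono)
  moreover have "centralizer G (cj g ` A) \<subseteq> carrier G" by (auto simp: centralizer_def)
  ultimately have "centralizer G (cj g ` A) \<subseteq> cj g ` centralizer G A" using assms by simp
  then show ?thesis using *[OF assms] by blast
qed

lemma normalizer_cj:
  assumes "g \<in> carrier G" "A \<subseteq> carrier G"
  shows "normalizer G (cj g ` A) = cj g ` normalizer G A"
proof -
  have *: "cj g ` normalizer G A \<subseteq> normalizer G (cj g ` A)" if "g \<in> carrier G" "A \<subseteq> carrier G" for g A
  proof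
    fix y assume "y \<in> cj g ` normalizer G A"
    then obtain x where "x \<in> normalizer G A" and y: "y = cj g x" by blast
    then have x: "x \<in> carrier G" "cj x ` A = A" "y = cj g x"
      using that by (simp_all add: normalizer_iff)
    have "cj y ` cj g ` A = cj (g \<otimes> x \<otimes> inv g \<otimes> g) ` A"
      using x that by (subst cj_image_mult) (auto simp: cj_def)
    also have "g \<otimes> x \<otimes> inv g \<otimes> g = g \<otimes> x" using x that by (simp add: m_assoc)
    also have "cj (g \<otimes> x) ` A = cj g ` A" using x that by (simp add: cj_image_mult)
    finally show "y \<in> normalizer G (cj g ` A)" using x that by (simp add: normalizer_iff cj_image_subset)
  qed
  have "cj (inv g) ` normalizer G (cj g ` A) \<subseteq> normalizer G A"
    using *[of "inv g" "cj g ` A"] assms by (simp add: cj_image_subset)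
  then have "cj g ` cj (inv g) ` normalizer G (cj g ` A) \<subseteq> cj g ` normalizer G A" by (rule image_mono)
  moreover have "normalizer G (cj g ` A) \<subseteq> carrier G" using assms by (auto simp: normalizer_iff cj_image_subset)
  ultimately have "normalizer G (cj g ` A) \<subseteq> cj g ` normalizer G A" using assms by simp
  then show ?thesis using *[OF assms] by blast
qed

lemma set_mult_cj:
  assumes "g \<in> carrier G" "A \<subseteq> carrier G" "B \<subseteq> carrier G"
  shows "cj g ` (A <#> B) = (cj g ` A) <#> (cj g ` B)"
proof -
  have "cj g (a \<otimes> b) = cj g a \<otimes> cj g b" if "a \<in> A" "b \<in> B" for a b
    using that assms by (intro cj_mult_right) auto
  then show ?thesis unfolding set_mult_def by force
qed

text \<open>Orbits that are not single points have p-power length divisible by \<open>p\<close>; the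
  induction discards one of them at a time. The action is a plain function, so that conjugation and
  translation of cosets can be inserted directly.\<close>

lemma p_fixed_points:
  assumes p: "prime p" and Q: "subgroup Q G" "card Q = p ^ n" and E: "finite E"
    and act: "\<And>g x. g \<in> Q \<Longrightarrow> x \<in> E \<Longrightarrow> act g x \<in> E" "\<And>x. x \<in> E \<Longrightarrow> act \<one> x = x"
      "\<And>g h x. g \<in> Q \<Longrightarrow> h \<in> Q \<Longrightarrow> x \<in> E \<Longrightarrow> act (g \<otimes> h) x = act g (act h x)"
  shows "card E mod p = card {x\<in>E. \<forall>g\<in>Q. act g x = x} mod p"
  using E act
proof (induction "card E" arbitrary: E rule: less_induct)
  case less
  note clo = less.prems(2) and one = less.prems(3) and mul = less.prems(4)
  show ?case
  proof (cases "\<forall>x\<in>E. \<forall>g\<in>Q. act g x = x")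
    case True
    then have "{x\<in>E. \<forall>g\<in>Q. act g x = x} = E" by auto
    then show ?thesis by simp
  next
    case False
    then obtain x g0 where x: "x \<in> E" "g0 \<in> Q" "act g0 x \<noteq> x" by auto
    let ?H = "G\<lparr>carrier := Q\<rparr>"
    \<comment> \<open>The restriction to \<open>E\<close> makes these maps extensional, as members
      of \<open>Bij E\<close> have to be for the orbit-stabilizer theorem.\<close>
    let ?\<phi> = "\<lambda>g. \<lambda>y\<in>E. act g y"
    have gH: "group ?H" using Q(1) by (rule subgroup_imp_group)
    have inv: "inv g \<in> Q" "g \<in> carrier G" if "g \<in> Q" for g
      using that Q(1) by (auto simp: subgroup.m_inv_closed subgroup.mem_carrier)
    have undo: "act (inv g) (act g y) = y" "act g (act (inv g) y) = y" if "g \<in> Q" "y \<in> E" for g y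
      using mul[of "inv g" g y] mul[of g "inv g" y] inv[OF that(1)] one[OF that(2)] that by simp_all
    have bij: "?\<phi> g \<in> Bij E" if "g \<in> Q" for g
    proof -
      have "bij_betw (act g) E E"
        by (rule bij_betw_byWitness[where f' = "act (inv g)"]) (use undo clo inv that in auto)
      then show ?thesis by (simp add: Bij_def bij_betw_cong[of E "?\<phi> g" "act g"])
    qed
    have "group_action ?H E ?\<phi>"
    proof (unfold group_action_def, rule group_hom.intro[OF gH group_BijGroup], rule group_hom_axioms.intro, rule homI)
      show "?\<phi> h \<in> carrier (BijGroup E)" if "h \<in> carrier ?H" for h
        using bij that by (simp add: BijGroup_def)
      show "?\<phi> (g \<otimes>\<^bsub>?H\<^esub> h) = ?\<phi> g \<otimes>\<^bsub>BijGroup E\<^esub> ?\<phi> h" if "g \<in> carrier ?H" "h \<in> carrier ?H" for g h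
        using that bij mul clo by (auto simp: BijGroup_def compose_def)
    qed
    from group_action.orbit_stabilizer_theorem[OF this x(1)]
    have "card (orbit ?H ?\<phi> x) * card (stabilizer ?H ?\<phi> x) = p ^ n"
      using Q(2) by (simp add: order_def)
    then have d: "card (orbit ?H ?\<phi> x) dvd p ^ n" by (metis dvd_triv_left)
    define Ob where "Ob = (\<lambda>g. act g x) ` Q"
    have "orbit ?H ?\<phi> x = Ob" using x by (auto simp: orbit_def Ob_def)
    with d have d: "card Ob dvd p ^ n" by simp
    have ObE: "Ob \<subseteq> E" using clo x by (auto simp: Ob_def)
    then have fOb: "finite Ob" using less.prems(1) finite_subset by blast
    have "\<one> \<in> Q" using Q(1) by (rule subgroup.one_closed)
    then have xOb: "x \<in> Ob" using one[OF x(1)] by (auto simp: Ob_def image_iff intro!: bexI[of _ \<one>])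
    have "act g0 x \<in> Ob" using x by (auto simp: Ob_def)
    have "card Ob \<noteq> 1" using xOb \<open>act g0 x \<in> Ob\<close> x(3) by (auto simp: card_1_singleton_iff)
    then have pd: "p dvd card Ob"
      using d p by (metis divides_primepow_nat dvd_power gr0I power_0)
    have stay: "act g y \<in> Ob" if gy: "g \<in> Q" "y \<in> Ob" for g y
    proof -
      obtain h where "h \<in> Q" "y = act h x" using gy by (auto simp: Ob_def)
      then show ?thesis using mul[of g h x] that x subgroup.m_closed[OF Q(1)]
        by (auto simp: Ob_def image_iff intro!: bexI[of _ "g \<otimes> h"])
    qed
    have Ob_in: "y \<in> Ob" if "g \<in> Q" "y \<in> E" "act g y \<in> Ob" for g y
      using stay[of "inv g" "act g y"] that undo inv by simp
    \<comment> \<open>An orbit with a fixed point is a single point, so removing \<open>Ob\<close>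
      leaves the set of fixed points unchanged.\<close>
    have nofix: "\<not> (\<forall>g\<in>Q. act g y = y)" if y: "y \<in> Ob" for y
    proof
      assume fix1: "\<forall>g\<in>Q. act g y = y"
      obtain h where h: "h \<in> Q" "y = act h x" using y by (auto simp: Ob_def)
      then have "x = act (inv h) y" using undo x by simp
      then have "x = y" using fix1 h inv by auto
      with fix1 x show False by auto
    qed
    have "card (E - Ob) mod p = card {x\<in>E - Ob. \<forall>g\<in>Q. act g x = x} mod p"
    proof (rule less.hyps)
      show "card (E - Ob) < card E" using less.prems(1) ObE xOb x by (intro psubset_card_mono) auto
      show "act g y \<in> E - Ob" if "g \<in> Q" "y \<in> E - Ob" for g y using that clo Ob_in by blast
    qed (use less.prems in auto)
    also have "{x\<in>E - Ob. \<forall>g\<in>Q. act g x = x} = {x\<in>E. \<forall>g\<in>Q. act g x = x}" using nofix by blast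
    finally have "card (E - Ob) mod p = card {x\<in>E. \<forall>g\<in>Q. act g x = x} mod p" .
    moreover have "card E = card (E - Ob) + card Ob"
      using fOb ObE less.prems(1) by (metis card_Diff_subset card_mono le_add_diff_inverse2)
    ultimately show ?thesis using pd by (simp add: mod_add_eq dvd_imp_mod_0 flip: mod_add_right_eq)
  qed
qed

text \<open>Sylow's theorem with exponent 1 provides a subgroup of order \<open>q\<close>.\<close>

lemma cauchy_element:
  assumes "prime q" "subgroup H G" "finite H" "q dvd card H"
  shows "\<exists>x\<in>H. x \<noteq> \<one> \<and> x [^] q = \<one>"
proof -
  let ?H = "G\<lparr>carrier := H\<rparr>"
  have gH: "group ?H" using assms(2) by (rule subgroup_imp_group)
  obtain m where "card H = q * m" using assms(4) by blast
  then have "order ?H = q ^ 1 * m" by (simp add: order_def)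
  from sylow_thm[OF assms(1) gH this] assms(3)
  obtain K where K: "subgroup K ?H" "card K = q ^ 1" by auto
  have "K \<noteq> {\<one>}" using K(2) prime_gt_1_nat[OF assms(1)] by auto
  moreover have "\<one> \<in> K" using subgroup.one_closed[OF K(1)] by simp
  ultimately obtain x where x: "x \<in> K" "x \<noteq> \<one>" by blast
  have KG: "subgroup K G" using incl_subgroup[OF assms(2)] K(1) by blast
  have gK: "group (G\<lparr>carrier := K\<rparr>)" using KG by (rule subgroup_imp_group)
  have "x [^]\<^bsub>G\<lparr>carrier := K\<rparr>\<^esub> order (G\<lparr>carrier := K\<rparr>) = \<one>"
    using group.pow_order_eq_1[OF gK, of x] x by simp
  then have "x [^] q = \<one>"
    using K(2) by (simp add: order_def flip: nat_pow_consistent)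
  moreover have "x \<in> H" using x subgroup.subset[OF K(1)] by auto
  ultimately show ?thesis using x by blast
qed

lemma pow_card_subgroup:
  assumes "subgroup H G" "x \<in> H" shows "x [^] card H = \<one>"
proof -
  have gK: "group (G\<lparr>carrier := H\<rparr>)" using assms by (intro subgroup_imp_group)
  have "x [^]\<^bsub>G\<lparr>carrier := H\<rparr>\<^esub> order (G\<lparr>carrier := H\<rparr>) = \<one>"
    using group.pow_order_eq_1[OF gK, of x] assms by simp
  then show ?thesis by (simp add: order_def flip: nat_pow_consistent)
qed

lemma coprime_pow_trivial:
  assumes "x \<in> carrier G" "x [^] (m::nat) = \<one>" "x [^] (n::nat) = \<one>" "coprime m n"
  shows "x = \<one>"
proof -
  have "ord x dvd m" "ord x dvd n" using assms by (simp_all flip: pow_eq_id)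
  then have "ord x = 1" using assms(4) by (metis coprime_common_divisor nat_dvd_1_iff_1)
  then show ?thesis using assms(1) ord_eq_1 by blast
qed

lemma card_subgroup_dvd:
  assumes "subgroup H G" "subgroup K G" "H \<subseteq> K" shows "card H dvd card K"
proof -
  have "subgroup H (G\<lparr>carrier := K\<rparr>)" using assms by (intro subgroup_incl)
  then have "card (rcosets\<^bsub>G\<lparr>carrier := K\<rparr>\<^esub> H) * card H = card K"
    using group.lagrange[OF subgroup_imp_group[OF assms(2)]] by (simp add: order_def)
  then show ?thesis by (metis dvd_triv_right)
qed

end

section \<open>Products, cosets and Sylow subgroups for a fixed prime\<close>

locale finite_group_prime = group +
  fixes p :: nat
  assumes fin [simp]: "finite (carrier G)" and prime_p: "prime p"
begin

abbreviation "psub \<equiv> p_subgroup G p"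

lemma finite_sub: "A \<subseteq> carrier G \<Longrightarrow> finite A"
  using fin by (rule finite_subset[rotated])

lemma psubD: "psub P \<Longrightarrow> subgroup P G" "psub P \<Longrightarrow> P \<subseteq> carrier G" "psub P \<Longrightarrow> finite P"
  "psub P \<Longrightarrow> \<one> \<in> P"
  using subgroup.subset subgroup.one_closed by (auto simp: p_subgroup_def intro: finite_sub)

text \<open>If another prime divided the order, Cauchy's theorem would give a nontrivial element of
  that prime order, which cannot have p-power order too. The elementwise form makes passage to
  subgroups and products immediate.\<close>

lemma psub_iff:
  assumes "subgroup P G"
  shows "psub P \<longleftrightarrow> (\<forall>x\<in>P. \<exists>k. x [^] (p ^ k) = \<one>)"
proof
  assume "psub P"
  then obtain n where "card P = p ^ n" by (auto simp: p_subgroup_def)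
  then show "\<forall>x\<in>P. \<exists>k. x [^] (p ^ k) = \<one>"
    using pow_card_subgroup[OF assms] by metis
next
  assume R: "\<forall>x\<in>P. \<exists>k. x [^] (p ^ k) = \<one>"
  have sub: "P \<subseteq> carrier G" using subgroup.subset[OF assms] .
  then have fP: "finite P" by (rule finite_sub)
  moreover have "\<one> \<in> P" using subgroup.one_closed[OF assms] .
  ultimately have c0: "card P \<noteq> 0" by auto
  moreover have "\<not> is_unit p" using prime_p by (simp add: prime_nat_iff)
  ultimately obtain m where m: "card P = p ^ multiplicity p (card P) * m" "\<not> p dvd m"
    by (meson multiplicity_decompose')
  have "m = 1"
  proof (rule ccontr)
    assume "m \<noteq> 1"
    then obtain q where q: "prime q" "q dvd m" using prime_factor_nat by blast
    then obtain x where x: "x \<in> P" "x \<noteq> \<one>" "x [^] q = \<one>"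
      using cauchy_element[OF q(1) assms fP] m(1) by (metis dvd_mult)
    have "q \<noteq> p" using q m(2) by blast
    obtain k where "x [^] (p ^ k) = \<one>" using R x by blast
    moreover have "coprime q (p ^ k)" using q(1) prime_p \<open>q \<noteq> p\<close> by (simp add: primes_coprime)
    ultimately show False using coprime_pow_trivial x sub by blast
  qed
  then have "card P = p ^ multiplicity p (card P)" using m(1) by simp
  then show "psub P" unfolding p_subgroup_def using assms by blast
qed

lemma psub_p'_trivial:
  assumes "psub P" "y \<in> P" "y [^] (k::nat) = \<one>" "coprime k p"
  shows "y = \<one>"
proof -
  obtain n where n: "y [^] (p ^ n) = \<one>"
    using assms(1,2) psub_iff[OF psubD(1)[OF assms(1)]] by blast
  show ?thesis
    by (rule coprime_pow_trivial[OF _ assms(3) n]) (use psubD(2)[OF assms(1)] assms in auto)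
qed

lemma psub_subset:
  assumes "psub P" "subgroup Q G" "Q \<subseteq> P" shows "psub Q"
  using assms(1) psub_iff[OF assms(2)] psub_iff[OF psubD(1)[OF assms(1)]] assms(3) by auto

lemma psub_one: "psub {\<one>}"
  unfolding p_subgroup_def using triv_subgroup by (auto intro: exI[of _ 0])

lemma psub_cj: "psub P \<Longrightarrow> g \<in> carrier G \<Longrightarrow> psub (cj g ` P)"
  using psubD(2)[of P] by (auto simp: p_subgroup_def subgroup_cj_image card_cj_image)

lemma set_mult_memI: "a \<in> A \<Longrightarrow> b \<in> B \<Longrightarrow> a \<otimes> b \<in> A <#> B"
  by (auto simp: set_mult_def)

lemma subgroup_mult:
  assumes P: "subgroup P G" and Q: "subgroup Q G" and nrm: "\<And>q x. q \<in> Q \<Longrightarrow> x \<in> P \<Longrightarrow> cj q x \<in> P"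
  shows "subgroup (P <#> Q) G"
proof (rule subgroupI)
  have sP: "\<And>x. x \<in> P \<Longrightarrow> x \<in> carrier G" and sQ: "\<And>x. x \<in> Q \<Longrightarrow> x \<in> carrier G"
    using subgroup.mem_carrier[OF P] subgroup.mem_carrier[OF Q] by auto
  show "P <#> Q \<subseteq> carrier G" using sP sQ by (auto simp: set_mult_def)
  show "P <#> Q \<noteq> {}" using subgroup.one_closed[OF P] subgroup.one_closed[OF Q] by (auto simp: set_mult_def)
  show "inv a \<in> P <#> Q" if a: "a \<in> P <#> Q" for a
  proof -
    obtain x q where xq: "x \<in> P" "q \<in> Q" "a = x \<otimes> q" using a by (auto simp: set_mult_def)
    have "inv a = cj (inv q) (inv x) \<otimes> inv q"
      using sP[OF xq(1)] sQ[OF xq(2)] xq(3) by (simp add: cj_def inv_mult_group m_assoc)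
    then show ?thesis
      using nrm[of "inv q" "inv x"] xq P Q by (auto intro!: set_mult_memI subgroup.m_inv_closed)
  qed
  show "a \<otimes> b \<in> P <#> Q" if a: "a \<in> P <#> Q" and b: "b \<in> P <#> Q" for a b
  proof -
    obtain x q where xq: "x \<in> P" "q \<in> Q" "a = x \<otimes> q" using a by (auto simp: set_mult_def)
    obtain y r where yr: "y \<in> P" "r \<in> Q" "b = y \<otimes> r" using b by (auto simp: set_mult_def)
    have "a \<otimes> b = (x \<otimes> cj q y) \<otimes> (q \<otimes> r)"
    proof -
      have "q \<otimes> (y \<otimes> r) = cj q y \<otimes> (q \<otimes> r)"
        using sP[OF yr(1)] sQ[OF xq(2)] sQ[OF yr(2)]
        unfolding cj_def by (metis inv_closed l_inv l_one m_assoc m_closed)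
      then show ?thesis using sP[OF yr(1)] sQ[OF xq(2)] sQ[OF yr(2)] sP[OF xq(1)] xq(3) yr(3)
        by (simp add: m_assoc)
    qed
    then show ?thesis
      using nrm[of q y] xq yr P Q by (auto intro!: set_mult_memI subgroup.m_closed)
  qed
qed

lemma set_mult_left:
  assumes "subgroup Q G" "P \<subseteq> carrier G" shows "P \<subseteq> P <#> Q"
proof
  fix x assume "x \<in> P"
  then show "x \<in> P <#> Q"
    using set_mult_memI[of x P \<one> Q] subgroup.one_closed[OF assms(1)] assms(2) by auto
qed

lemma set_mult_right:
  assumes "subgroup P G" "Q \<subseteq> carrier G" shows "Q \<subseteq> P <#> Q"
proof
  fix x assume "x \<in> Q"
  then show "x \<in> P <#> Q"
    using set_mult_memI[of \<one> P x Q] subgroup.one_closed[OF assms(1)] assms(2) by auto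
qed

text \<open>The powers of \<open>x \<otimes> q\<close> have the form
  \<open>y \<otimes> q [^] n\<close> with \<open>y\<close> in \<open>P\<close>; a p-power exponent
  killing \<open>q\<close> pushes them into \<open>P\<close>. This avoids counting the
  product.\<close>

lemma psub_mult:
  assumes P: "psub P" and Q: "psub Q" and nrm: "\<And>q x. q \<in> Q \<Longrightarrow> x \<in> P \<Longrightarrow> cj q x \<in> P"
  shows "psub (P <#> Q)"
proof -
  note gP = psubD(1)[OF P] and gQ = psubD(1)[OF Q]
  have sg: "subgroup (P <#> Q) G" using subgroup_mult[OF gP gQ nrm] .
  have "\<exists>k. a [^] (p ^ k) = \<one>" if a: "a \<in> P <#> Q" for a
  proof -
    obtain x q where xq: "x \<in> P" "q \<in> Q" "a = x \<otimes> q" using a by (auto simp: set_mult_def)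
    have c: "x \<in> carrier G" "q \<in> carrier G" "a \<in> carrier G"
      using xq psubD(2)[OF P] psubD(2)[OF Q] by auto
    have pw: "\<exists>y\<in>P. a [^] n = y \<otimes> q [^] n" for n :: nat
    proof (induction n)
      case 0
      show ?case using psubD(4)[OF P] by (auto intro!: bexI[of _ \<one>])
    next
      case (Suc n)
      then obtain y where y: "y \<in> P" "a [^] n = y \<otimes> q [^] n" by blast
      then have cy: "y \<in> carrier G" using psubD(2)[OF P] by auto
      have qn: "q [^] n \<in> Q"
        using xq(2) gQ by (induction n) (simp_all add: subgroup.one_closed subgroup.m_closed)
      have "a [^] Suc n = y \<otimes> q [^] n \<otimes> (x \<otimes> q)" using y(2) xq(3) by simp
      also have "\<dots> = (y \<otimes> cj (q [^] n) x) \<otimes> q [^] Suc n"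
      proof -
        have "q [^] n \<otimes> (x \<otimes> q) = cj (q [^] n) x \<otimes> (q [^] n \<otimes> q)"
          unfolding cj_def using c by (metis inv_closed l_inv l_one m_assoc m_closed nat_pow_closed)
        then show ?thesis using c cy by (simp add: m_assoc)
      qed
      finally show ?case using nrm[OF qn xq(1)] y(1) gP by (blast intro: subgroup.m_closed)
    qed
    obtain k where k: "q [^] (p ^ k) = \<one>" using Q xq(2) psub_iff[OF gQ] by blast
    obtain y where y: "y \<in> P" "a [^] (p ^ k) = y \<otimes> q [^] (p ^ k)" using pw by blast
    then have "a [^] (p ^ k) = y" using k psubD(2)[OF P] by auto
    moreover obtain j where "y [^] (p ^ j) = \<one>" using P y(1) psub_iff[OF gP] by blast
    ultimately have "a [^] (p ^ (k + j)) = \<one>" using c by (metis nat_pow_pow power_add)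
    then show ?thesis by blast
  qed
  then show ?thesis using psub_iff[OF sg] by blast
qed

text \<open>Let \<open>Q\<close> act on the right cosets of \<open>S\<close> by right multiplication
  with inverses: the coset of \<open>x\<close> is fixed exactly if conjugation by \<open>x\<close>
  takes \<open>Q\<close> into \<open>S\<close>. A Sylow subgroup for \<open>S\<close> gives Sylow
  containment, and \<open>S = Q\<close> gives growth of normalizers.\<close>

lemma coset_fixed_points:
  assumes S: "subgroup S G" and H: "subgroup H G" and SH: "S \<subseteq> H" and Q: "psub Q" and QH: "Q \<subseteq> H"
  shows "card {S #> x |x. x \<in> H} mod p = card {S #> x |x. x \<in> H \<and> (\<forall>q\<in>Q. cj x q \<in> S)} mod p"
    and "card {S #> x |x. x \<in> H} * card S = card H"
proof -
  have c: "\<And>x. x \<in> H \<Longrightarrow> x \<in> carrier G" "\<And>x. x \<in> Q \<Longrightarrow> x \<in> carrier G" "S \<subseteq> carrier G"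
    using subgroup.mem_carrier[OF H] psubD(2)[OF Q] subgroup.subset[OF S] by auto
  let ?E = "{S #> x |x. x \<in> H}"
  have E: "finite ?E" using finite_sub[OF subgroup.subset[OF H]] by simp
  let ?act = "\<lambda>g M. M #> inv g"
  obtain n where n: "card Q = p ^ n" using Q by (auto simp: p_subgroup_def)
  have a: "S #> x #> inv g = S #> (x \<otimes> inv g)" if "x \<in> H" "g \<in> Q" for x g
    using that c by (intro coset_mult_assoc) auto
  have inH: "x \<otimes> inv g \<in> H" if "x \<in> H" "g \<in> Q" for x g
    using that QH H by (blast intro: subgroup.m_closed subgroup.m_inv_closed)
  have "card ?E mod p = card {M\<in>?E. \<forall>g\<in>Q. ?act g M = M} mod p"
  proof (rule p_fixed_points[OF prime_p psubD(1)[OF Q] n E])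
    show "M #> inv g \<in> ?E" if "g \<in> Q" "M \<in> ?E" for g M
      using that a inH by blast
    show "M #> inv \<one> = M" if "M \<in> ?E" for M
      using that c r_coset_subset_G[of S] by auto
    show "M #> inv (g \<otimes> h) = M #> inv h #> inv g" if ghM: "g \<in> Q" "h \<in> Q" "M \<in> ?E" for g h M
    proof -
      obtain x where x: "x \<in> H" "M = S #> x" using ghM(3) by blast
      have "M \<subseteq> carrier G" using x c r_coset_subset_G[of S x] by auto
      then show ?thesis using that c by (simp add: coset_mult_assoc inv_mult_group)
    qed
  qed
  moreover have "{M\<in>?E. \<forall>g\<in>Q. ?act g M = M} = {S #> x |x. x \<in> H \<and> (\<forall>q\<in>Q. cj x q \<in> S)}"
  proof -
    have "S #> x #> inv g = S #> x \<longleftrightarrow> cj x g \<in> S" if "x \<in> H" "g \<in> Q" for x g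
    proof -
      have cx: "x \<in> carrier G" "g \<in> carrier G" using that c by auto
      have "S #> x #> inv g = S #> x \<longleftrightarrow> S #> x = S #> x #> g"
        using cx c(3) by (metis coset_mult_assoc coset_mult_one inv_closed l_inv r_coset_subset_G r_inv)
      also have "S #> x #> g = S #> (x \<otimes> g)" using cx c(3) by (rule coset_mult_assoc[rotated 1])
      also have "S #> x = S #> (x \<otimes> g) \<longleftrightarrow> x \<otimes> g \<in> S #> x"
        using cx c(3) S by (metis m_closed rcos_self repr_independence)
      also have "\<dots> \<longleftrightarrow> cj x g \<in> S"
        unfolding cj_def using subgroup.rcos_module[OF S is_group cx(1), of "x \<otimes> g"] cx by simp
      finally show ?thesis .
    qed
    then show ?thesis by blast
  qed
  ultimately show "card ?E mod p = card {S #> x |x. x \<in> H \<and> (\<forall>q\<in>Q. cj x q \<in> S)} mod p" by simp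
  have "rcosets\<^bsub>G\<lparr>carrier := H\<rparr>\<^esub> S = ?E" unfolding RCOSETS_def by auto
  moreover have "card (rcosets\<^bsub>G\<lparr>carrier := H\<rparr>\<^esub> S) * card S = card H"
    using group.lagrange[OF subgroup_imp_group[OF H] subgroup_incl[OF S H SH]] by (simp add: order_def)
  ultimately show "card ?E * card S = card H" by simp
qed

lemma normalizers_grow:
  assumes W: "psub W" and E: "subgroup E G" "E \<subset> W"
  obtains n where "n \<in> W - E" "\<And>e. e \<in> E \<Longrightarrow> cj n e \<in> E"
proof -
  note gW = psubD(1)[OF W]
  have sE: "E \<subseteq> W" using E by blast
  have pE: "psub E" using psub_subset[OF W E(1) sE] .
  note cf = coset_fixed_points[OF E(1) gW sE pE sE]
  let ?F = "{E #> x |x. x \<in> W \<and> (\<forall>q\<in>E. cj x q \<in> E)}"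
  let ?A = "{E #> x |x. x \<in> W}"
  have "card E < card W" using psubD(3)[OF W] E(2) by (rule psubset_card_mono)
  then have ne1: "card ?A \<noteq> 1" using cf(2) by auto
  obtain m where "card W = p ^ m" using W unfolding p_subgroup_def by blast
  then have "p ^ m = card ?A * card E" using cf(2) by simp
  then have "card ?A dvd p ^ m" by (rule dvdI)
  then obtain j where "card ?A = p ^ j" using divides_primepow_nat[OF prime_p] by blast
  with ne1 have "p dvd card ?A" by (cases j) auto
  then have pF: "p dvd card ?F" using cf(1) unfolding dvd_eq_mod_eq_0 by simp
  have "cj \<one> e \<in> E" if "e \<in> E" for e using that subgroup.mem_carrier[OF E(1)] by simp
  then have F1: "E \<in> ?F"
    using subgroup.subset[OF E(1)] psubD(4)[OF W] by (auto intro!: exI[of _ \<one>])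
  have fF: "finite ?F" using psubD(3)[OF W] by simp
  \<comment> \<open>The coset \<open>E\<close> is fixed and the number of fixed cosets is divisible
    by \<open>p\<close>, so there is another one; its representative is the desired element.\<close>
  have "?F \<noteq> {E}" using pF prime_gt_1_nat[OF prime_p] by auto
  then obtain M where "M \<in> ?F" "M \<noteq> E" using F1 by blast
  then obtain x where x: "x \<in> W" "\<forall>q\<in>E. cj x q \<in> E" "E #> x \<noteq> E" by blast
  then have "x \<notin> E" using subgroup.rcos_const[OF E(1) is_group] by blast
  then show thesis using that x by blast
qed

lemma sylow_exists: "\<exists>S. sylow_subgroup G p S"
proof -
  have "order G \<noteq> 0" using fin order_gt_0_iff_finite by simp
  moreover have "\<not> is_unit p" using prime_p by (simp add: prime_nat_iff)
  ultimately obtain m where "order G = p ^ multiplicity p (order G) * m"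
    by (meson multiplicity_decompose')
  then show ?thesis
    unfolding sylow_subgroup_def using sylow_thm[OF prime_p is_group] fin by blast
qed

lemma sylow_psub: "sylow_subgroup G p S \<Longrightarrow> psub S"
  by (auto simp: sylow_subgroup_def p_subgroup_def)

lemma sylow_cj: "sylow_subgroup G p S \<Longrightarrow> g \<in> carrier G \<Longrightarrow> sylow_subgroup G p (cj g ` S)"
  using subgroup.subset[of S G] by (simp add: sylow_subgroup_def subgroup_cj_image card_cj_image)

text \<open>The index of a Sylow subgroup is prime to \<open>p\<close>, so \<open>Q\<close> fixes
  one of its cosets and hence lies in a conjugate.\<close>

lemma sylow_above:
  assumes Q: "psub Q"
  obtains S where "sylow_subgroup G p S" "Q \<subseteq> S"
proof -
  obtain S where S: "sylow_subgroup G p S" using sylow_exists by blast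
  have gS: "subgroup S G" using S by (simp add: sylow_subgroup_def)
  note sub = subgroup.subset[OF gS]
  have gG: "subgroup (carrier G) G" by (rule subgroup_self)
  note cf = coset_fixed_points[OF gS gG sub Q psubD(2)[OF Q]]
  let ?F = "{S #> x |x. x \<in> carrier G \<and> (\<forall>q\<in>Q. cj x q \<in> S)}"
  let ?A = "{S #> x |x. x \<in> carrier G}"
  have "card ?A * p ^ multiplicity p (order G) = order G"
    using cf(2) S by (simp add: sylow_subgroup_def order_def)
  moreover have "order G \<noteq> 0" using fin order_gt_0_iff_finite by simp
  ultimately have "\<not> p dvd card ?A"
  proof (intro notI)
    assume eq: "card ?A * p ^ multiplicity p (order G) = order G" and nz: "order G \<noteq> 0" and "p dvd card ?A"
    then have "p * p ^ multiplicity p (order G) dvd card ?A * p ^ multiplicity p (order G)"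
      by (intro mult_dvd_mono) auto
    then have "p ^ Suc (multiplicity p (order G)) dvd order G" using eq by simp
    moreover have "\<not> is_unit p" using prime_p by (simp add: prime_nat_iff)
    ultimately show False
      using nz by (metis power_dvd_iff_le_multiplicity not_less_eq_eq order_refl)
  qed
  then have "card ?F \<noteq> 0" using cf(1) unfolding dvd_eq_mod_eq_0 by (intro notI) simp
  then have "?F \<noteq> {}" by (intro notI) simp
  then obtain x where x: "x \<in> carrier G" "\<forall>q\<in>Q. cj x q \<in> S" by blast
  have "q \<in> cj (inv x) ` S" if "q \<in> Q" for q
    using that x psubD(2)[OF Q] sub by (simp add: mem_cj_image_iff subset_iff)
  then show thesis using that sylow_cj[OF S, of "inv x"] x by blast
qed

text \<open>The class equation: under conjugation of \<open>S\<close> on itself the fixed points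
  form the center, whose order is thus divisible by \<open>p\<close>.\<close>

lemma nontrivial_center:
  assumes S: "psub S" "S \<noteq> {\<one>}"
  obtains z where "z \<in> S" "z \<noteq> \<one>" "z [^] p = \<one>" "\<And>s. s \<in> S \<Longrightarrow> z \<otimes> s = s \<otimes> z"
proof -
  note gS = psubD(1)[OF S(1)] and sub = psubD(2)[OF S(1)]
  obtain n where n: "card S = p ^ n" using S by (auto simp: p_subgroup_def)
  have cl: "cj g x \<in> S" if "g \<in> S" "x \<in> S" for g x
    unfolding cj_def using that gS by (blast intro: subgroup.m_closed subgroup.m_inv_closed)
  let ?Z = "S \<inter> centralizer G S"
  have "card S mod p = card {x\<in>S. \<forall>g\<in>S. cj g x = x} mod p"
    by (rule p_fixed_points[OF prime_p gS n psubD(3)[OF S(1)]])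
       (use cl sub in \<open>auto simp: cj_mult_left subset_iff\<close>)
  also have "{x\<in>S. \<forall>g\<in>S. cj g x = x} = ?Z"
    using sub by (auto simp: centralizer_def cj_fix_iff subset_iff)
  finally have m: "card S mod p = card ?Z mod p" .
  have "n \<noteq> 0"
  proof
    assume "n = 0"
    then have "card S = 1" using n by simp
    then show False using S(2) psubD(4)[OF S(1)] by (auto simp: card_1_singleton_iff)
  qed
  then have "p dvd card S" using n by simp
  then have "p dvd card ?Z" using m unfolding dvd_eq_mod_eq_0 by simp
  moreover have gZ: "subgroup ?Z G"
    using gS subgroup_centralizer[OF sub] by (rule subgroups_Inter_pair)
  ultimately obtain z where "z \<in> ?Z" "z \<noteq> \<one>" "z [^] p = \<one>"
    using cauchy_element[OF prime_p gZ] psubD(3)[OF S(1)] by blast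
  then show thesis using that by (auto simp: centralizer_def)
qed

end

section \<open>Centralizers of characteristic \<open>p\<close>\<close>

context finite_group_prime
begin

text \<open>Normal p-subgroups of the group on \<open>H\<close>, expressed within \<open>G\<close>.
  This keeps subgroups of different local subgroups comparable inside one group.\<close>

definition normal_psub :: "'a set \<Rightarrow> 'a set \<Rightarrow> bool" where
  "normal_psub H K \<longleftrightarrow> psub K \<and> K \<subseteq> H \<and> (\<forall>h\<in>H. \<forall>x\<in>K. cj h x \<in> K)"

abbreviation core :: "'a set \<Rightarrow> 'a set" where
  "core H \<equiv> p_core (G\<lparr>carrier := H\<rparr>) p"

lemma normal_psub_iff:
  assumes H: "subgroup H G"
  shows "K \<lhd> G\<lparr>carrier := H\<rparr> \<and> p_subgroup (G\<lparr>carrier := H\<rparr>) p K \<longleftrightarrow> normal_psub H K"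
proof -
  have s: "subgroup K (G\<lparr>carrier := H\<rparr>) \<longleftrightarrow> subgroup K G \<and> K \<subseteq> H"
    using incl_subgroup[OF H] subgroup_incl[OF _ H] subgroup.subset[of K "G\<lparr>carrier := H\<rparr>"] by auto
  have "K \<lhd> G\<lparr>carrier := H\<rparr> \<longleftrightarrow> subgroup K (G\<lparr>carrier := H\<rparr>) \<and> (\<forall>h\<in>H. \<forall>x\<in>K. cj h x \<in> K)"
    using m_inv_consistent[OF H] by (simp add: group.normal_inv_iff[OF subgroup_imp_group[OF H]] cj_def)
  then show ?thesis unfolding normal_psub_def p_subgroup_def s by blast
qed

text \<open>A normal p-subgroup \<open>K\<close> of greatest order contains every other one
  \<open>L\<close>, because the product of \<open>K\<close> and \<open>L\<close> is again a normal
  p-subgroup.\<close>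

lemma core_exists:
  assumes H: "subgroup H G"
  shows "\<exists>K. normal_psub H K \<and> (\<forall>L. normal_psub H L \<longrightarrow> L \<subseteq> K)"
proof -
  have sub: "H \<subseteq> carrier G" using subgroup.subset[OF H] .
  have "normal_psub H {\<one>}"
    using psub_one subgroup.one_closed[OF H] sub by (auto simp: normal_psub_def)
  moreover have "\<forall>K. normal_psub H K \<longrightarrow> card K < Suc (card (carrier G))"
    by (auto simp: normal_psub_def less_Suc_eq_le intro!: card_mono[OF fin] dest: psubD(2))
  ultimately obtain K where K: "normal_psub H K" "\<And>L. normal_psub H L \<Longrightarrow> card L \<le> card K"
    using ex_has_greatest_nat[of "normal_psub H" "{\<one>}" card] by blast
  have "L \<subseteq> K" if L: "normal_psub H L" for L
  proof -
    have pK: "psub K" "K \<subseteq> H" and pL: "psub L" "L \<subseteq> H" using K(1) L by (auto simp: normal_psub_def)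
    have pM: "psub (K <#> L)"
      using K(1) pL by (intro psub_mult pK pL(1)) (auto simp: normal_psub_def)
    have "cj h x \<in> K <#> L" if "h \<in> H" "x \<in> K <#> L" for h x
    proof -
      obtain a b where ab: "a \<in> K" "b \<in> L" "x = a \<otimes> b" using \<open>x \<in> K <#> L\<close> by (auto simp: set_mult_def)
      have "cj h x = cj h a \<otimes> cj h b"
        using ab \<open>h \<in> H\<close> pK pL sub by (auto intro: cj_mult_right)
      moreover have "cj h a \<in> K" "cj h b \<in> L" using K(1) L ab \<open>h \<in> H\<close> by (auto simp: normal_psub_def)
      ultimately show ?thesis by (simp add: set_mult_memI)
    qed
    moreover have "K <#> L \<subseteq> H"
      using pK(2) pL(2) subgroup.m_closed[OF H] by (auto simp: set_mult_def)
    ultimately have "normal_psub H (K <#> L)" using pM by (auto simp: normal_psub_def)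
    then have "card (K <#> L) \<le> card K" by (rule K(2))
    moreover have "K \<subseteq> K <#> L"
      using psubD(1)[OF pL(1)] psubD(2)[OF pK(1)] by (rule set_mult_left)
    ultimately have "K = K <#> L" using psubD(3)[OF pM] by (intro card_seteq) auto
    moreover have "L \<subseteq> K <#> L"
      using psubD(1)[OF pK(1)] psubD(2)[OF pL(1)] by (rule set_mult_right)
    ultimately show ?thesis by simp
  qed
  with K(1) show ?thesis by blast
qed

lemma core_properties:
  assumes H: "subgroup H G"
  shows "normal_psub H (core H)" "normal_psub H L \<Longrightarrow> L \<subseteq> core H"
proof -
  let ?R = "\<lambda>K. normal_psub H K \<and> (\<forall>L. normal_psub H L \<longrightarrow> L \<subseteq> K)"
  have c: "core H = (THE K. ?R K)"
    unfolding p_core_def normal_psub_iff[OF H] conj_assoc[symmetric] ..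
  obtain K where K: "?R K" using core_exists[OF H] by blast
  have "?R (THE K. ?R K)"
  proof (rule theI[of ?R, OF K])
    fix L assume "?R L" with K show "L = K" by blast
  qed
  then show "normal_psub H (core H)" "normal_psub H L \<Longrightarrow> L \<subseteq> core H" unfolding c by auto
qed

lemma core_psub: "subgroup H G \<Longrightarrow> psub (core H)"
  and core_subset: "subgroup H G \<Longrightarrow> core H \<subseteq> H"
  and core_normal: "subgroup H G \<Longrightarrow> h \<in> H \<Longrightarrow> x \<in> core H \<Longrightarrow> cj h x \<in> core H"
  using core_properties(1)[of H] by (auto simp: normal_psub_def)

lemma normal_psub_cj:
  assumes g: "g \<in> carrier G" and H: "subgroup H G" and K: "normal_psub H K"
  shows "normal_psub (cj g ` H) (cj g ` K)"
proof -
  have K': "psub K" "K \<subseteq> H" "\<And>h x. h \<in> H \<Longrightarrow> x \<in> K \<Longrightarrow> cj h x \<in> K"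
    using K by (auto simp: normal_psub_def)
  have "cj (cj g h) (cj g x) = cj g (cj h x)" if "h \<in> H" "x \<in> K" for h x
  proof -
    have "h \<in> carrier G" "x \<in> carrier G"
      using that subgroup.subset[OF H] psubD(2)[OF K'(1)] by auto
    then show ?thesis
      using g by (simp add: cj_def[of h x] cj_mult_right cj_inv_right cj_def[of "cj g h"])
  qed
  then show ?thesis using K' g by (auto simp: normal_psub_def psub_cj)
qed

lemma core_cj:
  assumes g: "g \<in> carrier G" and H: "subgroup H G"
  shows "core (cj g ` H) = cj g ` core H"
proof
  have sub: "H \<subseteq> carrier G" using subgroup.subset[OF H] .
  have gH: "subgroup (cj g ` H) G" using subgroup_cj_image[OF H g] .
  show "cj g ` core H \<subseteq> core (cj g ` H)"
    using normal_psub_cj[OF g H core_properties(1)[OF H]] by (rule core_properties(2)[OF gH])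
  have "normal_psub (cj (inv g) ` cj g ` H) (cj (inv g) ` core (cj g ` H))"
    using g by (intro normal_psub_cj gH core_properties(1)) auto
  then have "normal_psub H (cj (inv g) ` core (cj g ` H))" using g sub by simp
  then have "cj (inv g) ` core (cj g ` H) \<subseteq> core H" by (rule core_properties(2)[OF H])
  then have "cj g ` cj (inv g) ` core (cj g ` H) \<subseteq> cj g ` core H" by (rule image_mono)
  then show "core (cj g ` H) \<subseteq> cj g ` core H"
    using g psubD(2)[OF core_psub[OF gH]] by simp
qed

lemma core_invariant:
  assumes "g \<in> carrier G" "subgroup H G" "cj g ` H = H"
  shows "cj g ` core H = core H"
  using core_cj[OF assms(1,2)] assms(3) by simp

text \<open>Thompson's \<open>A \<times> B\<close> lemma for the cyclic group \<open>A\<close> generated by \<open>y\<close>.\<close>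

lemma AxB_lemma:
  assumes P: "psub P" and B: "psub B" and nrm: "\<And>b x. b \<in> B \<Longrightarrow> x \<in> P \<Longrightarrow> cj b x \<in> P"
    and y: "y \<in> carrier G" "y [^] (k::nat) = \<one>" "coprime k p"
    and yB: "\<And>b. b \<in> B \<Longrightarrow> y \<otimes> b = b \<otimes> y" and yP: "\<And>x. x \<in> P \<Longrightarrow> cj y x \<in> P"
    and CPB: "\<And>x. x \<in> P \<Longrightarrow> (\<And>b. b \<in> B \<Longrightarrow> x \<otimes> b = b \<otimes> x) \<Longrightarrow> x \<otimes> y = y \<otimes> x"
    and x: "x \<in> P"
  shows "x \<otimes> y = y \<otimes> x"
proof -
  note gP = psubD(1)[OF P] and gB = psubD(1)[OF B]
  have cP: "\<And>x. x \<in> P \<Longrightarrow> x \<in> carrier G" and cB: "\<And>x. x \<in> B \<Longrightarrow> x \<in> carrier G"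
    using psubD(2)[OF P] psubD(2)[OF B] by auto
  define W where "W = P <#> B"
  have W: "psub W" unfolding W_def using P B nrm by (rule psub_mult)
  note cW = subgroup.mem_carrier[OF psubD(1)[OF W]]
  have PW: "P \<subseteq> W" and BW: "B \<subseteq> W"
    unfolding W_def using set_mult_left[OF gB psubD(2)[OF P]] set_mult_right[OF gP psubD(2)[OF B]] by auto
  \<comment> \<open>The centralizer of \<open>y\<close> in \<open>W\<close>. Were it proper, some
    \<open>n\<close> outside \<open>E\<close> would normalize it; the commutator of \<open>y\<close>
    and \<open>n\<close> then turns out trivial, a contradiction.\<close>
  define E where "E = W \<inter> centralizer G {y}"
  have E: "subgroup E G"
    unfolding E_def using psubD(1)[OF W] y(1) by (intro subgroups_Inter_pair subgroup_centralizer) auto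
  have Eiff: "e \<in> E \<longleftrightarrow> e \<in> W \<and> e \<otimes> y = y \<otimes> e" for e
    using cW by (auto simp: E_def centralizer_def)
  have BE: "B \<subseteq> E" using BW yB by (auto simp: Eiff)
  have "E = W"
  proof (rule ccontr)
    assume "E \<noteq> W"
    then have "E \<subset> W" by (auto simp: E_def)
    then obtain n where n: "n \<in> W - E" "\<And>e. e \<in> E \<Longrightarrow> cj n e \<in> E"
      using normalizers_grow[OF W E] by blast
    have nW: "n \<in> carrier G" using n cW by auto
    \<comment> \<open>The commutator of \<open>y\<close> and \<open>n\<close>. Writing
      \<open>n = a \<otimes> b\<close> and using that \<open>y\<close> centralizes \<open>b\<close>,
      it reduces to the commutator of \<open>y\<close> and \<open>a\<close>, which lies in
      \<open>P\<close>.\<close>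
    define c where "c = cj y n \<otimes> inv n"
    obtain a b where ab: "a \<in> P" "b \<in> B" "n = a \<otimes> b" using n(1) by (auto simp: W_def set_mult_def)
    have "cj y b = b" using yB[OF ab(2)] cB[OF ab(2)] y(1) by (simp add: cj_fix_iff)
    then have "c = cj y a \<otimes> b \<otimes> inv (a \<otimes> b)"
      unfolding c_def ab(3) using cP[OF ab(1)] cB[OF ab(2)] y(1) by (simp add: cj_mult_right)
    also have "\<dots> = cj y a \<otimes> inv a"
    proof -
      have "b \<otimes> (inv b \<otimes> inv a) = inv a"
        using cP[OF ab(1)] cB[OF ab(2)] by (simp flip: m_assoc)
      then show ?thesis
        using cP[OF ab(1)] cB[OF ab(2)] y(1) by (simp add: inv_mult_group m_assoc)
    qed
    finally have cInP: "c \<in> P"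
      using yP[OF ab(1)] ab(1) gP by (auto intro: subgroup.m_closed subgroup.m_inv_closed)
    have cc: "c \<in> carrier G" using cP cInP .
    have cn: "c \<otimes> n = cj y n"
      unfolding c_def using nW y(1) by (simp add: m_assoc)
    \<comment> \<open>Since \<open>y\<close> centralizes \<open>E\<close> and \<open>n\<close>
      normalizes it, \<open>c \<otimes> n = cj y n\<close> acts on \<open>E\<close> just as
      \<open>n\<close> does. So \<open>c\<close> centralizes \<open>E\<close>, in particular
      \<open>B\<close>, and \<open>CPB\<close> applies to it.\<close>
    have "cj c e = e" if e: "e \<in> E" for e
    proof -
      have ce: "e \<in> carrier G" using e Eiff cW by auto
      have "cj n ` E \<subseteq> E" using n(2) by auto
      moreover have "inj_on (cj n) E"
        using inj_on_cj[OF nW] subgroup.subset[OF E] by (rule inj_on_subset)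
      ultimately have "cj n ` E = E"
        using finite_sub[OF subgroup.subset[OF E]] by (simp add: endo_inj_surj)
      then obtain f where f: "f \<in> E" "e = cj n f" using e by blast
      have cf: "f \<in> carrier G" using f Eiff cW by auto
      have yf: "cj (inv y) f = f" "cj y e = e"
        using f e Eiff y(1) cf ce by (metis cj_commute cj_inv_cj)+
      have "cj c e = cj (c \<otimes> n) f" unfolding f(2) using cc nW cf by (simp add: cj_mult_left)
      also have "\<dots> = cj (y \<otimes> n \<otimes> inv y) f" by (simp add: cn cj_def)
      also have "\<dots> = cj y (cj n (cj (inv y) f))" using y(1) nW cf by (simp add: cj_mult_left)
      also have "\<dots> = e" using yf f(2) by simp
      finally show ?thesis .
    qed
    then have fixed: "cj c b = b" if "b \<in> B" for b
      using that BE by blast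
    have "c \<otimes> b = b \<otimes> c" if "b \<in> B" for b
      using fixed[OF that] cB[OF that] cc by (simp add: cj_fix_iff)
    then have cy: "c \<otimes> y = y \<otimes> c" using CPB[OF cInP] by blast
    \<comment> \<open>As \<open>c\<close> commutes with \<open>y\<close>, conjugating
      \<open>n\<close> repeatedly by \<open>y\<close> accumulates powers of \<open>c\<close>. At
      \<open>j = k\<close> this yields \<open>c [^] k = \<one>\<close> for an element of a
      p-group.\<close>
    have pw: "cj (y [^] j) n = c [^] j \<otimes> n" for j :: nat
    proof (induction j)
      case 0
      show ?case using nW by simp
    next
      case (Suc j)
      have "cj (y [^] Suc j) n = cj (y \<otimes> y [^] j) n" using y(1) by (simp flip: nat_pow_Suc2)
      also have "\<dots> = cj y (c [^] j \<otimes> n)" using Suc y(1) nW by (simp add: cj_mult_left)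
      also have "\<dots> = cj y c [^] j \<otimes> cj y n" using y(1) nW cc by (simp add: cj_mult_right cj_pow)
      also have "cj y c = c" using cy cc y(1) by (simp add: cj_fix_iff)
      also have "c [^] j \<otimes> cj y n = c [^] Suc j \<otimes> n" unfolding cn[symmetric] using cc nW by (simp add: m_assoc)
      finally show ?case .
    qed
    have "c [^] k \<otimes> n = n" using pw[of k] y(2) nW by simp
    then have "c [^] k = \<one>" using cc nW by simp
    then have "c = \<one>" using psub_p'_trivial[OF P cInP] y(3) by blast
    then have "cj y n = n" using cn nW by simp
    then have "n \<in> E" using n(1) nW y(1) by (simp add: Eiff cj_fix_iff)
    then show False using n(1) by blast
  qed
  then show ?thesis using x PW Eiff by blast
qed

text \<open>For a subgroup \<open>H\<close> this amounts to characteristic p: a centralizer of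
  O_p(H) without nontrivial p'-elements is a p-group, and being normal in \<open>H\<close> it lies
  in O_p(H). Coprime action speaks about p'-elements, hence this form.\<close>

definition has_char_p :: "'a set \<Rightarrow> bool" where
  "has_char_p H \<longleftrightarrow> (\<forall>y\<in>H. \<forall>k::nat. coprime k p \<longrightarrow> y [^] k = \<one> \<longrightarrow>
     (\<forall>x\<in>core H. x \<otimes> y = y \<otimes> x) \<longrightarrow> y = \<one>)"

text \<open>C_P(B) is a normal p-subgroup of C_G(B), so it lies in the core. A p'-element
  centralizing the core therefore centralizes C_P(B), and by the A x B lemma all of
  \<open>P\<close>.\<close>

lemma has_char_p_centralizer:
  assumes B: "psub B" and P: "psub P"
    and nrm: "\<And>g x. g \<in> B \<union> centralizer G B \<Longrightarrow> x \<in> P \<Longrightarrow> cj g x \<in> P"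
    and triv: "\<And>y k. y \<in> centralizer G B \<Longrightarrow> coprime k p \<Longrightarrow> y [^] (k::nat) = \<one> \<Longrightarrow>
      (\<And>x. x \<in> P \<Longrightarrow> x \<otimes> y = y \<otimes> x) \<Longrightarrow> y = \<one>"
  shows "has_char_p (centralizer G B)"
  unfolding has_char_p_def
proof (intro ballI allI impI)
  let ?C = "centralizer G B"
  have C: "subgroup ?C G" using psubD(2)[OF B] by (rule subgroup_centralizer)
  fix y and k :: nat
  assume y: "y \<in> ?C" "coprime k p" "y [^] k = \<one>" and yc: "\<forall>x\<in>core ?C. x \<otimes> y = y \<otimes> x"
  have "cj h x \<in> ?C" if "h \<in> ?C" "x \<in> ?C" for h x
    unfolding cj_def using that C by (blast intro: subgroup.m_closed subgroup.m_inv_closed)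
  moreover have "psub (P \<inter> ?C)"
    using psubD(1)[OF P] C by (intro psub_subset[OF P] subgroups_Inter_pair) auto
  ultimately have "normal_psub ?C (P \<inter> ?C)" using nrm by (auto simp: normal_psub_def)
  then have PC: "P \<inter> ?C \<subseteq> core ?C" by (rule core_properties(2)[OF C])
  show "y = \<one>"
  proof (rule triv[OF y])
    fix x assume "x \<in> P"
    then show "x \<otimes> y = y \<otimes> x"
    proof (rule AxB_lemma[OF P B _ _ y(3,2), rotated -1])
      show "y \<in> carrier G" using y(1) by (simp add: centralizer_def)
      show "y \<otimes> b = b \<otimes> y" if "b \<in> B" for b using y(1) that by (simp add: centralizer_def)
      show "cj b x \<in> P" if "b \<in> B" "x \<in> P" for b x using that nrm by blast
      show "cj y x \<in> P" if "x \<in> P" for x using that y(1) nrm by blast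
      show "x \<otimes> y = y \<otimes> x" if "x \<in> P" "\<And>b. b \<in> B \<Longrightarrow> x \<otimes> b = b \<otimes> x" for x
        using that yc PC psubD(2)[OF P] by (auto simp: centralizer_def)
    qed
  qed
qed

text \<open>Each step goes from \<open>X\<close> to X' = N_Y(X), which is larger because normalizers
  grow. The preceding lemma applies with P = O_p(C_G(X)): X' normalizes C_G(X) and hence
  \<open>P\<close>, while C_G(X') is contained in C_G(X).\<close>

lemma has_char_p_overgroup:
  assumes "psub X" "psub Y" "X \<subseteq> Y" "has_char_p (centralizer G X)"
  shows "has_char_p (centralizer G Y)"
  using assms(1,3,4)
proof (induction "card Y - card X" arbitrary: X rule: less_induct)
  case less
  show ?case
  proof (cases "X = Y")
    case True
    then show ?thesis using less.prems by simp
  next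
    case False
    note sX = psubD(2)[OF less.prems(1)] and gX = psubD(1)[OF less.prems(1)]
    have gN: "subgroup (normalizer G X) G" using sX by (rule normalizer_imp_subgroup)
    define X' where "X' = Y \<inter> normalizer G X"
    have X': "psub X'"
      unfolding X'_def using assms(2) psubD(1)[OF assms(2)] gN
      by (intro psub_subset[OF assms(2)] subgroups_Inter_pair) auto
    have Niff: "g \<in> normalizer G X \<longleftrightarrow> g \<in> carrier G \<and> (\<forall>x\<in>X. cj g x \<in> X)" for g
      using sX by (rule normalizer_subgroup_iff[OF fin])
    have XX': "X \<subseteq> X'"
    proof
      fix x assume x: "x \<in> X"
      have "cj x z \<in> X" if "z \<in> X" for z
        unfolding cj_def using x that gX by (blast intro: subgroup.m_closed subgroup.m_inv_closed)
      then show "x \<in> X'" using x sX less.prems(2) by (auto simp: X'_def Niff)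
    qed
    have "X \<subset> Y" using False less.prems(2) by blast
    then obtain n where n: "n \<in> Y - X" "\<And>e. e \<in> X \<Longrightarrow> cj n e \<in> X"
      using normalizers_grow[OF assms(2) gX] by blast
    then have "n \<in> X'" using psubD(2)[OF assms(2)] by (auto simp: X'_def Niff)
    then have lt: "card X < card X'" using n XX' psubD(3)[OF X'] by (intro psubset_card_mono) auto
    have "card X' \<le> card Y" using psubD(3)[OF assms(2)] by (intro card_mono) (auto simp: X'_def)
    with lt have dec: "card Y - card X' < card Y - card X" by linarith
    let ?P = "core (centralizer G X)"
    have C: "subgroup (centralizer G X) G" using sX by (rule subgroup_centralizer)
    have CX: "centralizer G X' \<subseteq> centralizer G X" using XX' by (auto simp: centralizer_def)
    have "has_char_p (centralizer G X')"
    proof (rule has_char_p_centralizer[OF X' core_psub[OF C]])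
      fix g x assume g: "g \<in> X' \<union> centralizer G X'" and x: "x \<in> ?P"
      show "cj g x \<in> ?P"
      proof (cases "g \<in> X'")
        case True
        then have g': "g \<in> carrier G" "cj g ` X = X" using normalizer_iff[OF sX] by (auto simp: X'_def)
        then have "cj g ` centralizer G X = centralizer G X" using centralizer_cj[OF g'(1) sX] by simp
        then have "cj g ` ?P = ?P" using g'(1) C by (intro core_invariant)
        then show ?thesis using x by blast
      next
        case False
        then show ?thesis using g x CX by (intro core_normal[OF C]) auto
      qed
    next
      fix y and k :: nat
      assume "y \<in> centralizer G X'" "coprime k p" "y [^] k = \<one>" "\<And>x. x \<in> ?P \<Longrightarrow> x \<otimes> y = y \<otimes> x"
      then show "y = \<one>" using less.prems(3) CX unfolding has_char_p_def by blast
    qed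
    moreover have "X' \<subseteq> Y" by (simp add: X'_def)
    ultimately show ?thesis using less.hyps[OF dec X'] by blast
  qed
qed

section \<open>p-central elements and radical p-subgroups\<close>

lemma p_centralD:
  assumes "p_central G p x"
  shows "x \<in> carrier G" "x \<noteq> \<one>" "ord x = p"
  using assms ord_eq_1[of x] prime_p unfolding p_central_def by auto

lemma center_subgroup_eq: "Q \<subseteq> carrier G \<Longrightarrow> center (G\<lparr>carrier := Q\<rparr>) = Q \<inter> centralizer G Q"
  unfolding center_def centralizer_def by auto

lemma p_central_cj:
  assumes x: "p_central G p x" and g: "g \<in> carrier G"
  shows "p_central G p (cj g x)"
proof -
  note c = p_centralD(1)[OF x]
  obtain S where S: "sylow_subgroup G p S" "x \<in> center (G\<lparr>carrier := S\<rparr>)"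
    using x unfolding p_central_def by blast
  have sub: "S \<subseteq> carrier G" using psubD(2)[OF sylow_psub[OF S(1)]] .
  have "cj g x \<in> center (G\<lparr>carrier := cj g ` S\<rparr>)"
    using S(2) sub g by (auto simp: center_subgroup_eq centralizer_cj cj_image_subset)
  moreover have "ord (cj g x) = p"
  proof -
    have "cj g x [^] n = \<one> \<longleftrightarrow> x [^] n = \<one>" for n :: nat
      using cj_eq_iff[OF g, of "x [^] n" \<one>] c g by (simp flip: cj_pow)
    then have "ord (cj g x) = ord x"
      using ord_unique[of "cj g x" "ord x"] c g by (simp add: pow_eq_id)
    then show ?thesis using p_centralD(3)[OF x] by simp
  qed
  ultimately show ?thesis
    using c g sylow_cj[OF S(1) g] unfolding p_central_def by blast
qed

text \<open>The normalizer of the group generated by \<open>x\<close> contains the Sylow subgroup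
  that centralizes \<open>x\<close>. It is thus both local and parabolic, and its core serves as the
  group \<open>P\<close> when passing down to the centralizer.\<close>

lemma has_char_p_p_central:
  assumes G: "parabolic_characteristic_p G p" and x: "p_central G p x"
  shows "psub (generate G {x})" "has_char_p (centralizer G (generate G {x}))"
proof -
  note c = p_centralD[OF x]
  let ?X = "generate G {x}"
  have X: "subgroup ?X G" using c(1) by (intro generate_is_subgroup) auto
  have "card ?X = p ^ 1" using generate_pow_card[OF c(1)] c(3) by simp
  then show pX: "psub ?X" unfolding p_subgroup_def using X by blast
  note sX = psubD(2)[OF pX]
  have xX: "x \<in> ?X" by (rule generate.incl) simp
  define H where "H = normalizer G ?X"
  have Hiff: "g \<in> H \<longleftrightarrow> g \<in> carrier G \<and> (\<forall>y\<in>?X. cj g y \<in> ?X)" for g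
    unfolding H_def using sX by (rule normalizer_subgroup_iff[OF fin])
  have gH: "subgroup H G" unfolding H_def using sX by (rule normalizer_imp_subgroup)
  have comm: "cj g y = y" if g: "g \<in> carrier G" "g \<otimes> x = x \<otimes> g" and y: "y \<in> ?X" for g y
  proof -
    have "x \<otimes> g = g \<otimes> x" using g by simp
    then have "?X \<subseteq> centralizer G {g}"
      using c(1) g(1) by (intro generate_subgroup_incl subgroup_centralizer) (auto simp: centralizer_def)
    then show ?thesis using y g(1) by (auto simp: centralizer_def cj_fix_iff)
  qed
  obtain S where S: "sylow_subgroup G p S" "x \<in> center (G\<lparr>carrier := S\<rparr>)"
    using x unfolding p_central_def by blast
  have sS: "S \<subseteq> carrier G" using psubD(2)[OF sylow_psub[OF S(1)]] .
  have "S \<subseteq> H"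
  proof
    fix s assume s: "s \<in> S"
    have "s \<otimes> x = x \<otimes> s" using S(2) s sS by (simp add: center_subgroup_eq centralizer_def)
    then show "s \<in> H" using s sS comm[of s] by (auto simp: Hiff)
  qed
  then have "parabolic G p H" unfolding parabolic_def using gH S(1) by blast
  moreover have "p_local G p H" unfolding p_local_def H_def using pX xX c(2) by blast
  ultimately have "characteristic_p (G\<lparr>carrier := H\<rparr>) p"
    using G unfolding parabolic_characteristic_p_def by blast
  then have ch: "y \<in> core H" if "y \<in> H" "\<And>z. z \<in> core H \<Longrightarrow> y \<otimes> z = z \<otimes> y" for y
    using that unfolding characteristic_p_def by (auto simp: centralizer_def)
  have CH: "centralizer G ?X \<subseteq> H"
  proof
    fix g assume "g \<in> centralizer G ?X"
    then have "g \<in> carrier G" "g \<otimes> x = x \<otimes> g" using xX by (auto simp: centralizer_def)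
    then show "g \<in> H" using comm[of g] by (simp add: Hiff)
  qed
  have XH: "?X \<subseteq> H"
  proof
    fix g assume g: "g \<in> ?X"
    have "cj g y \<in> ?X" if "y \<in> ?X" for y
      unfolding cj_def using g that X by (blast intro: subgroup.m_closed subgroup.m_inv_closed)
    then show "g \<in> H" using g sX by (auto simp: Hiff)
  qed
  show "has_char_p (centralizer G ?X)"
  proof (rule has_char_p_centralizer[OF pX core_psub[OF gH]])
    show "cj g y \<in> core H" if "g \<in> ?X \<union> centralizer G ?X" "y \<in> core H" for g y
      using that CH XH by (intro core_normal[OF gH]) auto
  next
    fix y and k :: nat
    assume y: "y \<in> centralizer G ?X" "coprime k p" "y [^] k = \<one>"
      and yc: "\<And>z. z \<in> core H \<Longrightarrow> z \<otimes> y = y \<otimes> z"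
    have "y \<in> core H" using y(1) CH yc by (intro ch) auto
    then show "y = \<one>" using psub_p'_trivial[OF core_psub[OF gH]] y by blast
  qed
qed

text \<open>Raising an element to the p-part of the group order leaves a p'-element, which is
  trivial by assumption.\<close>

lemma psub_if_no_p'_elements:
  assumes C: "subgroup C G" and t: "\<And>y k. y \<in> C \<Longrightarrow> coprime k p \<Longrightarrow> y [^] (k::nat) = \<one> \<Longrightarrow> y = \<one>"
  shows "psub C"
  unfolding psub_iff[OF C]
proof
  fix x assume x: "x \<in> C"
  have cx: "x \<in> carrier G" using subgroup.mem_carrier[OF C x] .
  have "card C \<noteq> 0" using x finite_sub[OF subgroup.subset[OF C]] by auto
  moreover have "\<not> is_unit p" using prime_p by (simp add: prime_nat_iff)
  ultimately obtain m where m: "card C = p ^ multiplicity p (card C) * m" "\<not> p dvd m"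
    by (meson multiplicity_decompose')
  let ?a = "p ^ multiplicity p (card C)"
  have "coprime m p" using prime_imp_coprime[OF prime_p m(2)] by (subst coprime_commute)
  moreover have "(x [^] ?a) [^] m = \<one>"
  proof -
    have "(x [^] ?a) [^] m = x [^] (?a * m)" using cx by (rule nat_pow_pow)
    also have "?a * m = card C" using m(1) by simp
    finally show ?thesis using pow_card_subgroup[OF C x] by simp
  qed
  moreover have "x [^] n \<in> C" for n :: nat
    using x by (induction n) (simp_all add: subgroup.one_closed[OF C] subgroup.m_closed[OF C])
  ultimately have "x [^] ?a = \<one>" using t by blast
  then show "\<exists>k. x [^] (p ^ k) = \<one>" by blast
qed

lemma subgroup_normalizer: "A \<subseteq> carrier G \<Longrightarrow> subgroup (normalizer G A) G"
  by (rule normalizer_imp_subgroup)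

lemma subset_normalizer:
  assumes "subgroup Q G" shows "Q \<subseteq> normalizer G Q"
proof
  fix g assume g: "g \<in> Q"
  have "cj g y \<in> Q" if "y \<in> Q" for y
    unfolding cj_def using g that assms by (blast intro: subgroup.m_closed subgroup.m_inv_closed)
  then show "g \<in> normalizer G Q"
    using g subgroup.subset[OF assms] by (auto simp: normalizer_subgroup_iff)
qed

lemma normal_psub_normalizer: "psub Q \<Longrightarrow> normal_psub (normalizer G Q) Q"
  using subset_normalizer[OF psubD(1), of Q] psubD(2)[of Q]
  by (auto simp: normal_psub_def normalizer_subgroup_iff)

text \<open>O_p(C_G(Q)) is normal in N_G(Q), so radicality puts it into \<open>Q\<close>, where all
  of C_G(Q) centralizes it. Characteristic p then excludes p'-elements from C_G(Q), which thereby
  becomes a normal p-subgroup of N_G(Q) and lies in \<open>Q\<close> too.\<close>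

lemma radical_self_centralizing:
  assumes G: "parabolic_characteristic_p G p" and x: "p_central G p x" "x \<in> Q"
    and Q: "psub Q" "Q = core (normalizer G Q)"
  shows "centralizer G Q \<subseteq> Q" "psub (centralizer G Q)"
proof -
  note sQ = psubD(2)[OF Q(1)]
  let ?C = "centralizer G Q" and ?N = "normalizer G Q"
  have C: "subgroup ?C G" and N: "subgroup ?N G"
    using subgroup_centralizer[OF sQ] subgroup_normalizer[OF sQ] by auto
  have "generate G {x} \<subseteq> Q" using x(2) psubD(1)[OF Q(1)] by (intro generate_subgroup_incl) auto
  then have ch: "has_char_p ?C"
    using has_char_p_overgroup[OF _ Q(1)] has_char_p_p_central[OF G x(1)] by blast
  have CN: "?C \<subseteq> ?N"
    using sQ by (auto simp: centralizer_def normalizer_subgroup_iff cj_commute subset_iff)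
  have inv: "cj h ` ?C = ?C" "h \<in> carrier G" if "h \<in> ?N" for h
    using that sQ by (auto simp: normalizer_iff simp flip: centralizer_cj)
  have "normal_psub ?N (core ?C)"
    unfolding normal_psub_def
  proof (intro conjI ballI)
    show "psub (core ?C)" using C by (rule core_psub)
    show "core ?C \<subseteq> ?N" using core_subset[OF C] CN by blast
    show "cj h y \<in> core ?C" if "h \<in> ?N" "y \<in> core ?C" for h y
      using core_invariant[OF inv(2)[OF that(1)] C inv(1)[OF that(1)]] that(2) by blast
  qed
  then have "core ?C \<subseteq> Q" using core_properties(2)[OF N] Q(2) by blast
  then have t: "y = \<one>" if "y \<in> ?C" "coprime k p" "y [^] (k::nat) = \<one>" for y k
    using that ch unfolding has_char_p_def by (fastforce simp: centralizer_def)
  show pC: "psub ?C" using C t by (rule psub_if_no_p'_elements)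
  have "normal_psub ?N ?C" using pC CN inv by (auto simp: normal_psub_def)
  then show "?C \<subseteq> Q" using core_properties(2)[OF N] Q(2) by blast
qed

lemma multiplicity_card_psub: "psub P \<Longrightarrow> card P = p ^ multiplicity p (card P)"
  using prime_p unfolding p_subgroup_def by (auto simp: prime_nat_iff)

text \<open>Take a Sylow subgroup \<open>S\<close> above \<open>W\<close>. Its intersection with
  C_G(Q) is a p-subgroup of C_G(Q) containing the Sylow subgroup Z(Q), so it equals Z(Q). Central
  elements of \<open>S\<close> lie in this intersection, hence in \<open>Q\<close>.\<close>

lemma centric_contains_p_central:
  assumes pG: "p dvd order G" and W: "psub W" and QW: "Q \<subseteq> W" and Q: "p_centric G p Q"
  obtains z where "z \<in> Q" "p_central G p z" "\<And>w. w \<in> W \<Longrightarrow> z \<otimes> w = w \<otimes> z"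
proof -
  have pQ: "psub Q" using Q by (simp add: p_centric_def)
  note sQ = psubD(2)[OF pQ]
  let ?C = "centralizer G Q"
  have C: "subgroup ?C G" using sQ by (rule subgroup_centralizer)
  have syl: "card (Q \<inter> ?C) = p ^ multiplicity p (card ?C)"
    using Q sQ by (simp add: p_centric_def sylow_subgroup_def center_subgroup_eq order_def)
  obtain S where S: "sylow_subgroup G p S" "W \<subseteq> S" using sylow_above[OF W] .
  note pS = sylow_psub[OF S(1)]
  have "order G \<noteq> 0" using fin order_gt_0_iff_finite by simp
  moreover have "\<not> is_unit p" using prime_p by (simp add: prime_nat_iff)
  ultimately have "1 \<le> multiplicity p (order G)"
    using pG by (simp flip: power_dvd_iff_le_multiplicity)
  then have "p dvd card S" using S(1) by (simp add: sylow_subgroup_def)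
  then have "S \<noteq> {\<one>}" using prime_gt_1_nat[OF prime_p] by auto
  then obtain z where z: "z \<in> S" "z \<noteq> \<one>" "z [^] p = \<one>" "\<And>s. s \<in> S \<Longrightarrow> z \<otimes> s = s \<otimes> z"
    using nontrivial_center[OF pS] by blast
  have cz: "z \<in> carrier G" using psubD(2)[OF pS] z(1) by blast
  have "ord z dvd p" using z(3) cz by (simp add: pow_eq_id)
  then have "ord z = p" using prime_p z(2) ord_eq_1[OF cz] by (auto simp: prime_nat_iff)
  then have "p_central G p z"
    using z(1,4) cz S(1) psubD(2)[OF pS] unfolding p_central_def
    by (auto simp: center_subgroup_eq centralizer_def)
  moreover have "z \<in> Q"
  proof -
    have M: "psub (S \<inter> ?C)"
      using psubD(1)[OF pS] C by (intro psub_subset[OF pS] subgroups_Inter_pair) auto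
    then obtain j where j: "card (S \<inter> ?C) = p ^ j" unfolding p_subgroup_def by blast
    have "p ^ j dvd card ?C" using card_subgroup_dvd[OF psubD(1)[OF M] C] j by simp
    moreover have "card ?C \<noteq> 0"
      using finite_sub[OF subgroup.subset[OF C]] subgroup.one_closed[OF C] by auto
    moreover have "\<not> is_unit p" using prime_p by (simp add: prime_nat_iff)
    ultimately have "j \<le> multiplicity p (card ?C)" by (simp add: power_dvd_iff_le_multiplicity)
    then have "card (S \<inter> ?C) \<le> card (Q \<inter> ?C)"
      unfolding j syl using prime_gt_0_nat[OF prime_p] by (intro power_increasing) auto
    moreover have "Q \<inter> ?C \<subseteq> S \<inter> ?C" using QW S(2) by blast
    ultimately have "Q \<inter> ?C = S \<inter> ?C" using psubD(3)[OF M] by (intro card_seteq)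
    moreover have "z \<in> S \<inter> ?C" using z QW S(2) cz by (auto simp: centralizer_def)
    ultimately show ?thesis by blast
  qed
  ultimately show thesis using that z(4) S(2) by blast
qed

text \<open>Trades centricity for the presence of a p-central element, a condition inherited by
  larger p-subgroups. After this only radicality separates D(G)^T from
  \<open>stable_psubs T\<close>.\<close>

lemma centric_radicals_iff:
  assumes G: "parabolic_characteristic_p G p" and pG: "p dvd order G"
  shows "Q \<in> centric_radicals G p \<longleftrightarrow>
    psub Q \<and> (\<exists>x\<in>Q. p_central G p x) \<and> Q = core (normalizer G Q)"
proof
  assume "Q \<in> centric_radicals G p"
  then have Q: "psub Q" "p_centric G p Q" "Q = core (normalizer G Q)"
    by (auto simp: centric_radicals_def p_radical_def)
  moreover obtain z where "z \<in> Q" "p_central G p z"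
    using centric_contains_p_central[OF pG Q(1) subset_refl Q(2)] by blast
  ultimately show "psub Q \<and> (\<exists>x\<in>Q. p_central G p x) \<and> Q = core (normalizer G Q)" by blast
next
  assume R: "psub Q \<and> (\<exists>x\<in>Q. p_central G p x) \<and> Q = core (normalizer G Q)"
  then obtain x where x: "p_central G p x" "x \<in> Q" by blast
  have Q: "psub Q" "Q = core (normalizer G Q)" using R by auto
  let ?C = "centralizer G Q"
  note C = radical_self_centralizing[OF G x Q]
  have "center (G\<lparr>carrier := Q\<rparr>) = ?C"
    using C(1) by (auto simp: center_subgroup_eq[OF psubD(2)[OF Q(1)]])
  moreover have "subgroup ?C (G\<lparr>carrier := ?C\<rparr>)"
    using psubD(1)[OF C(2)] by (intro subgroup_incl) auto
  ultimately have "p_centric G p Q"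
    unfolding p_centric_def sylow_subgroup_def
    using Q(1) multiplicity_card_psub[OF C(2)] by (simp add: order_def)
  moreover have "Q \<noteq> {\<one>}" using x p_centralD(2) by blast
  ultimately show "Q \<in> centric_radicals G p"
    using Q by (simp add: centric_radicals_def p_radical_def)
qed

end

section \<open>The fixed point poset\<close>

context finite_group_prime
begin

lemma normalizer_set_mult:
  assumes "t \<in> normalizer G A" "t \<in> normalizer G B" "A \<subseteq> carrier G" "B \<subseteq> carrier G"
  shows "t \<in> normalizer G (A <#> B)"
  using assms setmult_subset_G[of A B] by (simp add: normalizer_iff set_mult_cj)

lemma normalizer_Int:
  assumes "t \<in> normalizer G A" "t \<in> normalizer G B" "A \<subseteq> carrier G" "B \<subseteq> carrier G"
  shows "t \<in> normalizer G (A \<inter> B)"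
proof -
  have "A \<inter> B \<subseteq> carrier G" using assms by blast
  then show ?thesis using assms by (simp add: normalizer_subgroup_iff)
qed

lemma cj_image_Int:
  "g \<in> carrier G \<Longrightarrow> A \<subseteq> carrier G \<Longrightarrow> B \<subseteq> carrier G \<Longrightarrow> cj g ` (A \<inter> B) = cj g ` A \<inter> cj g ` B"
  by (rule inj_on_image_Int[OF inj_on_cj])

lemma subgroup_normalizes_normal:
  assumes "subgroup H G" "K \<subseteq> H" "\<And>h x. h \<in> H \<Longrightarrow> x \<in> K \<Longrightarrow> cj h x \<in> K"
  shows "H \<subseteq> normalizer G K"
  using assms subgroup.subset[OF assms(1)] by (auto simp: normalizer_subgroup_iff)

text \<open>The poset S of the overview. A T-invariant p-subgroup containing a member is again a
  member, which gives the room that the homotopies need.\<close>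

definition stable_psubs :: "'a set \<Rightarrow> 'a set set" where
  "stable_psubs T = {Q. psub Q \<and> (\<exists>x\<in>Q. p_central G p x) \<and> T \<subseteq> normalizer G Q}"

context
  fixes T :: "'a set"
  assumes T: "psub T"
begin

lemma stable_psubsD:
  assumes "Q \<in> stable_psubs T"
  shows "psub Q" "subgroup Q G" "Q \<subseteq> carrier G" "T \<subseteq> normalizer G Q"
  using assms psubD by (auto simp: stable_psubs_def)

lemma stable_psubsI:
  "psub R \<Longrightarrow> Q \<in> stable_psubs T \<Longrightarrow> Q \<subseteq> R \<Longrightarrow> T \<subseteq> normalizer G R \<Longrightarrow> R \<in> stable_psubs T"
  unfolding stable_psubs_def by blast

lemma normalizer_T:
  assumes "n \<in> normalizer G T" shows "n \<in> carrier G" "cj n ` T = T"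
  using assms psubD(2)[OF T] by (auto simp: normalizer_iff)

lemma cj_image_stable:
  assumes "n \<in> normalizer G T" "Q \<in> stable_psubs T"
  shows "cj n ` Q \<in> stable_psubs T"
proof -
  note n = normalizer_T[OF assms(1)] and Q = stable_psubsD[OF assms(2)]
  have "cj n ` T \<subseteq> cj n ` normalizer G Q" using Q(4) by (rule image_mono)
  then have "T \<subseteq> normalizer G (cj n ` Q)" using n Q(3) by (simp add: normalizer_cj)
  moreover obtain x where "x \<in> Q" "p_central G p x" using assms(2) by (auto simp: stable_psubs_def)
  ultimately show ?thesis
    using n Q(1) psub_cj p_central_cj unfolding stable_psubs_def by blast
qed

lemma stable_psubs_action:
  "finite_poset_action (normalizer G T) (stable_psubs T) (conjugate G)"
proof
  show "finite (stable_psubs T)"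
  proof (rule finite_subset)
    show "stable_psubs T \<subseteq> Pow (carrier G)"
    proof
      fix Q assume "Q \<in> stable_psubs T"
      then show "Q \<in> Pow (carrier G)" using stable_psubsD(3)[of Q] by simp
    qed
  qed simp
  fix n v assume n: "n \<in> normalizer G T" and v: "v \<in> stable_psubs T"
  note n' = normalizer_T[OF n] and v' = stable_psubsD(3)[OF v]
  show "conjugate G n v \<in> stable_psubs T"
    using cj_image_stable[OF n v] n' v' by (simp add: conjugate_eq)
  fix w assume "w \<in> stable_psubs T"
  then have "w \<subseteq> carrier G" by (rule stable_psubsD(3))
  then show "conjugate G n v \<le> conjugate G n w \<longleftrightarrow> v \<le> w"
    using n' v' inj_on_image_subset_iff[OF inj_on_cj[OF n'(1)]] by (simp add: conjugate_eq)
qed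

text \<open>Normalizers grow in \<open>R\<close>, which puts N_R(Q) strictly above \<open>Q\<close>;
  failure of radicality puts O_p(N_G(Q)) strictly above \<open>Q\<close>. Their product is a p-group
  since N_R(Q) normalizes that core.\<close>

lemma conical_above_stable_psubs:
  "conical_above (normalizer G T) (stable_psubs T) (conjugate G)
     {Q \<in> stable_psubs T. Q = core (normalizer G Q)}
     (\<lambda>Q R. R \<inter> normalizer G Q)
     (\<lambda>Q R. core (normalizer G Q) <#> (R \<inter> normalizer G Q))
     (\<lambda>Q. core (normalizer G Q))"
    (is "conical_above ?N ?S ?act ?D ?f ?g ?c")
proof (rule conical_above.intro[OF stable_psubs_action], rule conical_above_axioms.intro)
  have N: "subgroup (normalizer G Q) G" if "Q \<in> ?S" for Q
    using subgroup_normalizer stable_psubsD(3)[OF that] .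
  have act: "?act n A = cj n ` A" "n \<in> carrier G" if "n \<in> ?N" "A \<subseteq> carrier G" for n A
    using normalizer_T[OF that(1)] that(2) conjugate_eq by auto
  have Nact: "normalizer G (?act n Q) = cj n ` normalizer G Q" and cact: "core (normalizer G (?act n Q)) = ?act n (core (normalizer G Q))"
    if "n \<in> ?N" "Q \<in> ?S" for n Q
  proof -
    note Q = stable_psubsD(3)[OF that(2)]
    show e: "normalizer G (?act n Q) = cj n ` normalizer G Q"
      using act[OF that(1) Q] Q by (simp add: normalizer_cj)
    show "core (normalizer G (?act n Q)) = ?act n (core (normalizer G Q))"
      unfolding e using act[OF that(1)] N[OF that(2)] psubD(2)[OF core_psub[OF N[OF that(2)]]]
      by (simp add: core_cj act(2)[OF that(1) Q])
  qed
  have cS: "core (normalizer G Q) \<in> ?S" and cge: "Q \<subseteq> core (normalizer G Q)" if Q: "Q \<in> ?S" for Q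
  proof -
    note Q' = stable_psubsD[OF Q]
    show *: "Q \<subseteq> core (normalizer G Q)"
      using normal_psub_normalizer[OF Q'(1)] by (rule core_properties(2)[OF N[OF Q]])
    have "normalizer G Q \<subseteq> normalizer G (core (normalizer G Q))"
      by (rule subgroup_normalizes_normal[OF N[OF Q] core_subset[OF N[OF Q]] core_normal[OF N[OF Q]]])
    then show "core (normalizer G Q) \<in> ?S"
      using Q'(4) by (intro stable_psubsI[OF core_psub[OF N[OF Q]] Q *]) auto
  qed
  have fS: "?f Q R \<in> ?S" and flt: "Q \<subset> ?f Q R" if Q: "Q \<in> ?S" and R: "R \<in> ?S" "Q \<subset> R" for Q R
  proof -
    note Q' = stable_psubsD[OF Q] and R' = stable_psubsD[OF R(1)]
    have QN: "Q \<subseteq> normalizer G Q" using subset_normalizer[OF Q'(2)] .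
    obtain n where n: "n \<in> R - Q" "\<And>e. e \<in> Q \<Longrightarrow> cj n e \<in> Q"
      using normalizers_grow[OF R'(1) Q'(2) R(2)] by blast
    then have "n \<in> normalizer G Q" using R'(3) Q'(3) by (auto simp: normalizer_subgroup_iff)
    with n QN R(2) show lt: "Q \<subset> ?f Q R" by blast
    have p: "psub (?f Q R)"
      using R'(2) N[OF Q] by (intro psub_subset[OF R'(1)] subgroups_Inter_pair) auto
    have "T \<subseteq> normalizer G (?f Q R)"
    proof
      fix t assume t: "t \<in> T"
      have "t \<in> normalizer G (normalizer G Q)"
        using subset_normalizer[OF N[OF Q]] Q'(4) t by blast
      then show "t \<in> normalizer G (?f Q R)"
        using t R'(3,4) subgroup.subset[OF N[OF Q]] by (intro normalizer_Int) auto
    qed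
    then show "?f Q R \<in> ?S" using lt by (intro stable_psubsI[OF p Q]) auto
  qed
  have g: "?g Q R \<in> ?S" "?f Q R \<subseteq> ?g Q R" "core (normalizer G Q) \<subseteq> ?g Q R"
    if Q: "Q \<in> ?S" and R: "R \<in> ?S" "Q \<subset> R" for Q R
  proof -
    note F = stable_psubsD[OF fS[OF Q R]] and C = stable_psubsD[OF cS[OF Q]]
    have p: "psub (?g Q R)"
      by (rule psub_mult[OF C(1) F(1)]) (use core_normal[OF N[OF Q]] in auto)
    show "?f Q R \<subseteq> ?g Q R" using C(2) F(3) by (rule set_mult_right)
    show c: "core (normalizer G Q) \<subseteq> ?g Q R" using F(2) C(3) by (rule set_mult_left)
    have "T \<subseteq> normalizer G (?g Q R)"
      using C(3,4) F(3,4) by (auto intro!: normalizer_set_mult)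
    then show "?g Q R \<in> ?S" by (rule stable_psubsI[OF p cS[OF Q] c])
  qed
  show "?D \<subseteq> ?S" by blast
  show "?act n v \<in> ?D \<longleftrightarrow> v \<in> ?D" if "n \<in> ?N" "v \<in> ?S" for n v
  proof -
    note v = stable_psubsD(3)[OF that(2)]
    have c: "core (normalizer G v) \<subseteq> carrier G" using stable_psubsD(3)[OF cS[OF that(2)]] .
    have "?act n v \<in> ?S" using stable_psubs_action that by (rule finite_poset_action.act_closed)
    then show ?thesis
      using that cact[OF that] act[OF that(1)] v c inj_on_image_eq_iff[OF inj_on_cj[OF act(2)[OF that(1) v]] v c]
      by auto
  qed
  show "?f Q R \<in> ?S \<and> Q < ?f Q R \<and> ?f Q R \<le> R" if "Q \<in> ?S - ?D" "R \<in> ?S" "Q < R" for Q R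
    using fS flt that by auto
  show "?g Q R \<in> ?S \<and> ?f Q R \<le> ?g Q R" if "Q \<in> ?S - ?D" "R \<in> ?S" "Q < R" for Q R
    using g that by auto
  show "?c Q \<in> ?S \<and> Q < ?c Q" if "Q \<in> ?S - ?D" for Q
    using cS[of Q] cge[of Q] that by auto
  show "?c Q \<le> ?g Q R" if "Q \<in> ?S - ?D" "R \<in> ?S" "Q < R" for Q R
    using g(3) that by auto
  show "?f Q R \<le> ?f Q R'" if "R \<le> R'" for Q R R' :: "'a set" using that by auto
  show "?g Q R \<le> ?g Q R'" if "R \<le> R'" for Q R R' :: "'a set"
    using that by (intro mono_set_mult) auto
  show fact: "?f (?act n Q) (?act n R) = ?act n (?f Q R)"
    if "n \<in> ?N" "Q \<in> ?S - ?D" "R \<in> ?S" for n Q R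
  proof -
    have Q: "Q \<in> ?S" using that by blast
    note R = stable_psubsD(3)[OF that(3)]
    have "?f Q R \<subseteq> carrier G" using R by blast
    then show ?thesis
      using R act[OF that(1)] Nact[OF that(1) Q] subgroup.subset[OF N[OF Q]]
      by (simp add: cj_image_Int act(2)[OF that(1) R])
  qed
  show "?g (?act n Q) (?act n R) = ?act n (?g Q R)"
    if "n \<in> ?N" "Q \<in> ?S - ?D" "R \<in> ?S" "Q < R" for n Q R
  proof -
    have Q: "Q \<in> ?S" and QR: "Q \<subset> R" using that by auto
    have c: "core (normalizer G Q) \<subseteq> carrier G" "?f Q R \<subseteq> carrier G" "?g Q R \<subseteq> carrier G"
      using stable_psubsD(3) cS[OF Q] fS[OF Q that(3) QR] g(1)[OF Q that(3) QR] by blast+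
    show ?thesis
      unfolding fact[OF that(1-3)] cact[OF that(1) Q]
      using act[OF that(1)] c by (simp add: set_mult_cj act(2)[OF that(1) c(1)])
  qed
  show "?c (?act n Q) = ?act n (?c Q)" if "n \<in> ?N" "Q \<in> ?S - ?D" for n Q
    using cact that by blast
qed

end

section \<open>The null-homotopy of the inclusion and the conclusion\<close>

lemma fixed_centric_radicals_contractible:
  assumes G: "parabolic_characteristic_p G p" and pG: "p dvd order G" and T: "psub T"
    and x: "x \<in> core (T <#> centralizer G T)" "p_central G p x"
  shows "poset_equivariantly_contractible
    (normalizer G T) (centric_radicals_fixed G p T) (conjugate G)"
proof -
  define C where "C = T <#> centralizer G T"
  let ?S = "stable_psubs T" and ?N = "normalizer G T" and ?D = "centric_radicals_fixed G p T"
  note sT = psubD(2)[OF T] and gT = psubD(1)[OF T]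
  have D_eq: "?D = {Q \<in> ?S. Q = core (normalizer G Q)}"
    unfolding centric_radicals_fixed_def centric_radicals_iff[OF G pG] stable_psubs_def by blast
  note conical = conical_above_stable_psubs[OF T, folded D_eq]
  interpret conical_above ?N ?S "conjugate G" ?D "\<lambda>Q R. R \<inter> normalizer G Q"
    "\<lambda>Q R. core (normalizer G Q) <#> (R \<inter> normalizer G Q)" "\<lambda>Q. core (normalizer G Q)"
    by (rule conical)
  have cent: "subgroup (centralizer G T) G" using sT by (rule subgroup_centralizer)
  have C: "subgroup C G"
    unfolding C_def using gT cent
  proof (rule subgroup_mult)
    show "cj c t \<in> T" if "c \<in> centralizer G T" "t \<in> T" for c t
      using that sT cj_commute[of c t] by (auto simp: centralizer_def)
  qed
  note sC = subgroup.subset[OF C]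
  have TC: "T \<subseteq> C" unfolding C_def using cent sT by (rule set_mult_left)
  have centC: "centralizer G T \<subseteq> C" unfolding C_def using gT subgroup.subset[OF cent] by (rule set_mult_right)
  note pO = core_psub[OF C]
  note sO = psubD(2)[OF pO] and gO = psubD(1)[OF pO]
  have CO: "C \<subseteq> normalizer G (core C)"
    using C core_subset[OF C] core_normal[OF C] by (rule subgroup_normalizes_normal)
  have O: "core C \<in> ?S"
    using pO x TC CO unfolding stable_psubs_def C_def by blast
  have QC: "Q \<inter> C \<in> ?S" if Q: "Q \<in> ?D" for Q
  proof -
    have QS: "Q \<in> ?S" using Q D_eq by blast
    note Q' = stable_psubsD[OF T QS]
    have "p_centric G p Q" using Q by (simp add: centric_radicals_fixed_def centric_radicals_def)
    moreover have "psub (Q <#> T)"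
    proof (rule psub_mult[OF Q'(1) T])
      show "cj t y \<in> Q" if "t \<in> T" "y \<in> Q" for t y
        using that Q'(3,4) normalizer_subgroup_iff[OF fin Q'(3)] by blast
    qed
    ultimately obtain z where z: "z \<in> Q" "p_central G p z" "\<And>w. w \<in> Q <#> T \<Longrightarrow> z \<otimes> w = w \<otimes> z"
      using centric_contains_p_central[OF pG, of "Q <#> T" Q] set_mult_left[OF gT Q'(3)] by blast
    \<comment> \<open>The p-central element \<open>z\<close> commutes with \<open>T\<close>, so it
      lies in C_G(T) and with it in \<open>C\<close>. Cutting \<open>Q\<close> down to
      \<open>C\<close> thus keeps a p-central element.\<close>
    have "T \<subseteq> Q <#> T" using Q'(2) sT by (rule set_mult_right)
    then have "z \<in> centralizer G T" using z(3) p_centralD(1)[OF z(2)] by (auto simp: centralizer_def)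
    then have "z \<in> Q \<inter> C" using z(1) centC by blast
    moreover have "psub (Q \<inter> C)"
      using Q'(2) C by (intro psub_subset[OF Q'(1)] subgroups_Inter_pair) auto
    moreover have "T \<subseteq> normalizer G (Q \<inter> C)"
      using Q'(3,4) sC TC subset_normalizer[OF C] by (auto intro!: normalizer_Int)
    ultimately show ?thesis using z(2) unfolding stable_psubs_def by blast
  qed
  have OQC: "core C <#> (Q \<inter> C) \<in> ?S" "Q \<inter> C \<subseteq> core C <#> (Q \<inter> C)" "core C \<subseteq> core C <#> (Q \<inter> C)"
    if Q: "Q \<in> ?D" for Q
  proof -
    note QC' = stable_psubsD[OF T QC[OF Q]]
    have p: "psub (core C <#> (Q \<inter> C))"
      by (rule psub_mult[OF pO QC'(1)]) (use core_normal[OF C] in auto)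
    show c: "core C \<subseteq> core C <#> (Q \<inter> C)" using QC'(2) sO by (rule set_mult_left)
    show "Q \<inter> C \<subseteq> core C <#> (Q \<inter> C)" using gO QC'(3) by (rule set_mult_right)
    have "T \<subseteq> normalizer G (core C <#> (Q \<inter> C))"
      using sO TC CO QC'(3,4) by (auto intro!: normalizer_set_mult)
    then show "core C <#> (Q \<inter> C) \<in> ?S" by (rule stable_psubsI[OF T p O c])
  qed
  have act: "conjugate G n A = cj n ` A" "n \<in> carrier G" if "n \<in> ?N" "A \<subseteq> carrier G" for n A
    using normalizer_T[OF T that(1)] that(2) conjugate_eq by auto
  \<comment> \<open>N_G(T) normalizes both factors of \<open>C\<close>, hence \<open>C\<close> and
    its core. So the final vertex is fixed, and all maps of the chain are equivariant.\<close>
  have actC: "cj n ` C = C" if "n \<in> ?N" for n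
    using normalizer_T[OF T that] sT subgroup.subset[OF cent]
    by (simp add: C_def set_mult_cj flip: centralizer_cj)
  have actO: "conjugate G n (core C) = core C" if "n \<in> ?N" for n
    using act[OF that sO] core_invariant[OF act(2)[OF that sO] C actC[OF that]] by simp
  have actQC: "conjugate G n Q \<inter> C = conjugate G n (Q \<inter> C)" if "n \<in> ?N" "Q \<in> ?D" for n Q
  proof -
    have Q: "Q \<subseteq> carrier G" using stable_psubsD(3)[OF T, of Q] that(2) D_eq by blast
    then have "Q \<inter> C \<subseteq> carrier G" by blast
    then show ?thesis
      using act[OF that(1)] Q actC[OF that(1)] sC cj_image_Int[OF act(2)[OF that(1) Q] Q sC] by simp
  qed
  have actOQC: "core C <#> (conjugate G n Q \<inter> C) = conjugate G n (core C <#> (Q \<inter> C))"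
    if "n \<in> ?N" "Q \<in> ?D" for n Q
  proof -
    have c: "Q \<inter> C \<subseteq> carrier G" "core C <#> (Q \<inter> C) \<subseteq> carrier G"
      using stable_psubsD(3)[OF T] QC[OF that(2)] OQC(1)[OF that(2)] by blast+
    show ?thesis
      unfolding actQC[OF that] using act[OF that(1)] c sO actO[OF that(1)]
      by (simp add: set_mult_cj act(2)[OF that(1) sO])
  qed
  have D_action: "finite_poset_action ?N ?D (conjugate G)"
    using act_D D_subset by (intro action_subset) auto
  note hom = homotopic_affine_extensions[OF D_action finite_poset_action_axioms]
  let ?hom = "homotopic_with (equivariant ?N (realization (order_complex ?D))
        (\<lambda>n. affine_extension (conjugate G n)) (\<lambda>n. affine_extension (conjugate G n)))
       (realization (order_complex ?D)) (realization (order_complex ?S))"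
  have mono: "mono_on ?D (\<lambda>Q. core C <#> (Q \<inter> C))"
    by (rule mono_onI, rule mono_set_mult) auto
  have 1: "?hom (affine_extension (\<lambda>Q. Q)) (affine_extension (\<lambda>Q. Q \<inter> C))"
    by (rule hom) (use QC actQC D_subset in \<open>auto simp: mono_on_def\<close>)
  \<comment> \<open>The only step that goes up: the homotopy for comparable maps runs downwards and
    is reversed here.\<close>
  have 2: "?hom (affine_extension (\<lambda>Q. Q \<inter> C)) (affine_extension (\<lambda>Q. core C <#> (Q \<inter> C)))"
    by (subst homotopic_with_sym, rule hom)
       (use QC actQC OQC actOQC mono in \<open>auto simp: mono_on_def\<close>)
  have 3: "?hom (affine_extension (\<lambda>Q. core C <#> (Q \<inter> C))) (affine_extension (\<lambda>Q. core C))"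
    by (rule hom) (use OQC actOQC O actO mono in \<open>auto simp: mono_on_def\<close>)
  have 4: "?hom (affine_extension (\<lambda>Q. Q)) (affine_extension (\<lambda>Q. core C))"
    using homotopic_with_trans[OF homotopic_with_trans[OF 1 2] 3] .
  show ?thesis
    using conical O actO 4 by (rule contractible_via_retract)
qed

end

theorem theorem3p3:
  fixes G :: "('a, 'b) monoid_scheme" (structure)
    and p :: nat
    and T :: "'a set"
  assumes "prime p"
    and "group G"
    and "finite (carrier G)"
    and "parabolic_characteristic_p G p"
    and "p dvd order G"
    and "p_subgroup G p T"
    and "\<exists>x \<in> p_core (G\<lparr>carrier := T <#> centralizer G T\<rparr>) p. p_central G p x"
  shows "poset_equivariantly_contractible
           (normalizer G T) (centric_radicals_fixed G p T) (conjugate G)"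
proof -
  interpret group G by fact
  interpret finite_group_prime G p by unfold_locales (use assms in auto)
  show ?thesis using assms fixed_centric_radicals_contractible by blast
qed

end
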